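(* Let $V\in C^2(\mathbb{R},\mathbb{R})$ satisfy $V(x)\ge0$ for all $x$, $V(-1)=V(1)=0$, $V(x)>0$ for $x\in(-1,1)$, and $V''(-1),V''(1)>0$. Let $a:\mathbb{R}\to\mathbb{R}$ be continuous and asymptotically periodic: there is a continuous periodic function $a_P:\mathbb{R}\to\mathbb{R}$ with $|a(t)-a_P(t)|\to0$ as $|t|\to+\infty$ and $0<\inf_{s\in\mathbb{R}}a(s)\le a(t)<a_P(t)$ for all $t\in\mathbb{R}$. Then for each $\epsilon>0$ the problem $\ddot x(t)=a(\epsilon t)V'(x(t))$, $t\in\mathbb{R}$, $x(t)\to-1$ as $t\to-\infty$, $x(t)\to1$ as $t\to+\infty$, has a solution $x\in H^1_{loc}(\mathbb{R})\cap C^2(\mathbb{R})$. Moreover, $x(t)\in(-1,1)$ for all $t\in\mathbb{R}$. *)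

theory Defs
  imports "HOL-Analysis.Analysis"
begin

definition C2_with :: "(real \<Rightarrow> real) \<Rightarrow> (real \<Rightarrow> real) \<Rightarrow> (real \<Rightarrow> real) \<Rightarrow> bool" where
  "C2_with f f1 f2 \<longleftrightarrow>
     (\<forall>x. (f has_real_derivative f1 x) (at x)) \<and>
     (\<forall>x. (f1 has_real_derivative f2 x) (at x)) \<and>
     continuous_on UNIV f2"

definition periodic_fun :: "(real \<Rightarrow> real) \<Rightarrow> bool" where
  "periodic_fun g \<longleftrightarrow> (\<exists>T>0. \<forall>t. g (t + T) = g t)"

end

theory Submission
  imports Defs "HOL-Complex_Analysis.Great_Picard"
begin

text \<open>
  Minimise a discretised action instead of working in \<open>H\<^sup>1\<close>. After a rescaling the period is \<open>1\<close>.
  On the grid of mesh \<open>1/n\<close>, sequences with values in \<open>[-1, 1]\<close> that equal \<open>-1\<close> left of \<open>-n\<close> and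
  \<open>1\<close> right of \<open>n\<close> form a compact set, so the action has a minimiser, which solves the discrete
  equation and has slopes bounded uniformly in \<open>n\<close>. Since a ramp into a well at distance \<open>\<theta>\<close>
  costs \<open>O(\<theta>)\<close>, a minimiser that has come close to a well cannot leave it on the outer side, and
  the action bound makes it come close within a bounded time. If the transition ran off to infinity
  as \<open>n \<rightarrow> \<infinity>\<close>, shifting it back by an integer number of periods would lower the action by a
  definite amount, because \<open>a < a\<^sub>P\<close> and \<open>a - a\<^sub>P \<rightarrow> 0\<close>. Hence the transitions stay bounded, and a
  pointwise limit of the minimisers is a heteroclinic solution. It avoids \<open>\<plusminus>1\<close> by uniqueness for
  the initial value problem at an equilibrium.
\<close>

section \<open>Discrete action\<close>

lemma sum_int_telescope:
  fixes f :: "int \<Rightarrow> real"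
  assumes "a \<le> b"
  shows "(\<Sum>i\<in>{a..<b}. f (i + 1) - f i) = f b - f a"
  using assms
proof (induction b rule: int_ge_induct)
  case (step i)
  have "{a..<i + 1} = insert i {a..<i}" using step.hyps by auto
  then show ?case using step.IH by simp
qed simp

lemma sum_int_split:
  fixes f :: "int \<Rightarrow> real"
  assumes "a \<le> b" "b \<le> c"
  shows "sum f {a..<c} = sum f {a..<b} + sum f {b..<c}"
proof -
  have "{a..<c} = {a..<b} \<union> {b..<c}" using assms by auto
  then show ?thesis by (simp add: sum.union_disjoint)
qed

text \<open>The mean slope over the window is at most \<open>2 / n\<close>, and slopes oscillate by at most \<open>M / n\<close>.\<close>

lemma discrete_slope_bound_upper:
  fixes u :: "int \<Rightarrow> real" and n :: nat
  assumes n: "n \<ge> 1"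
    and bound: "\<And>i. w \<le> i \<Longrightarrow> i \<le> w + int n \<Longrightarrow> \<bar>u i\<bar> \<le> 1"
    and second: "\<And>i. w < i \<Longrightarrow> i < w + int n \<Longrightarrow>
                   \<bar>u (i + 1) - 2 * u i + u (i - 1)\<bar> \<le> M / (real n)\<^sup>2"
    and M: "M \<ge> 0" and i: "w \<le> i" "i < w + int n"
  shows "u (i + 1) - u i \<le> (M + 2) / n"
proof (rule ccontr)
  define d where "d i = u (i + 1) - u i" for i
  have var: "\<bar>d k - d j\<bar> \<le> real_of_int (k - j) * (M / (real n)\<^sup>2)"
    if "w \<le> j" "j \<le> k" "k < w + int n" for j k
    using that(2,3)
  proof (induction k rule: int_ge_induct)
    case (step k)
    have "\<bar>d (k + 1) - d k\<bar> \<le> M / (real n)\<^sup>2"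
      using second[of "k + 1"] step that by (simp add: d_def algebra_simps)
    with step show ?case by (simp add: algebra_simps add_divide_distrib diff_divide_distrib)
  qed simp
  have osc: "\<bar>d k - d j\<bar> \<le> M / n" if "w \<le> j" "j \<le> k" "k < w + int n" for j k
  proof -
    have "real_of_int (k - j) * (M / (real n)\<^sup>2) \<le> real n * (M / (real n)\<^sup>2)"
      using that M by (intro mult_right_mono) auto
    also have "\<dots> = M / n" using n by (simp add: power2_eq_square)
    finally show ?thesis using var[OF that] by linarith
  qed
  assume "\<not> ?thesis"
  then have big: "d i > (M + 2) / n" by (simp add: d_def)
  have all: "d j > 2 / n" if "w \<le> j" "j < w + int n" for j
  proof -
    have "\<bar>d j - d i\<bar> \<le> M / n"
      using osc[of i j] osc[of j i] that i by (cases "i \<le> j") (auto simp: abs_minus_commute)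
    with big show ?thesis by (simp add: add_divide_distrib)
  qed
  \<comment> \<open>The window has exactly \<open>n\<close> cells, so slopes all above
    \<open>2 / n\<close> would give a total rise above \<open>2\<close>, more than the width of
    \<open>[-1, 1]\<close>.\<close>
  have "(\<Sum>j\<in>{w..<w + int n}. 2 / real n) < (\<Sum>j\<in>{w..<w + int n}. d j)"
    using n by (intro sum_strict_mono) (auto intro: all)
  also have "\<dots> = u (w + int n) - u w"
    unfolding d_def by (rule sum_int_telescope) auto
  also have "\<dots> \<le> 2" using bound[of w] bound[of "w + int n"] by auto
  finally show False using n by simp
qed

lemma discrete_slope_bound:
  fixes u :: "int \<Rightarrow> real" and n :: nat
  assumes n: "n \<ge> 1"
    and bound: "\<And>i. w \<le> i \<Longrightarrow> i \<le> w + int n \<Longrightarrow> \<bar>u i\<bar> \<le> 1"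
    and second: "\<And>i. w < i \<Longrightarrow> i < w + int n \<Longrightarrow>
                   \<bar>u (i + 1) - 2 * u i + u (i - 1)\<bar> \<le> M / (real n)\<^sup>2"
    and M: "M \<ge> 0" and i: "w \<le> i" "i < w + int n"
  shows "\<bar>u (i + 1) - u i\<bar> \<le> (M + 2) / n"
proof -
  have "\<bar>- u (i + 1) - 2 * - u i + - u (i - 1)\<bar> \<le> M / (real n)\<^sup>2"
    if "w < i" "i < w + int n" for i
    using second[OF that] by linarith
  then have "- u (i + 1) - - u i \<le> (M + 2) / n"
    by (intro discrete_slope_bound_upper[of n w "\<lambda>i. - u i" M i]) (use assms in auto)
  with discrete_slope_bound_upper[OF assms] show ?thesis by linarith
qed

lemma int_Lipschitz_of_steps:
  fixes p :: "int \<Rightarrow> real"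
  assumes "\<And>i. \<bar>p (i + 1) - p i\<bar> \<le> c"
  shows "\<bar>p j - p i\<bar> \<le> c * \<bar>real_of_int (j - i)\<bar>"
proof -
  have *: "\<bar>p j - p i\<bar> \<le> c * (j - i)" if "i \<le> j" for i j
    using that
  proof (induction j rule: int_ge_induct)
    case (step k)
    then show ?case using assms[of k] by (simp add: algebra_simps)
  qed simp
  show ?thesis
    using *[of i j] *[of j i] by (cases "i \<le> j") (auto simp: abs_minus_commute)
qed

text \<open>The setting for everything that concerns a single minimiser: \<open>b\<close> is the
  coefficient after rescaling time, and only its two-sided bound enters. The periodic comparison
  coefficient comes in later, in \<open>asymptotically_periodic_well\<close>.\<close>

locale double_well =
  fixes V V' b :: "real \<Rightarrow> real" and b0 B D :: real
  assumes V_deriv: "(V has_real_derivative V' x) (at x)"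
    and V_nonneg: "V x \<ge> 0"
    and V_zero: "V (-1) = 0" "V 1 = 0"
    and V_pos: "\<bar>x\<bar> < 1 \<Longrightarrow> V x > 0"
    and V'_bound: "\<bar>x\<bar> \<le> 1 \<Longrightarrow> \<bar>V' x\<bar> \<le> D"
    and b0_pos: "b0 > 0"
    and b_lower: "b0 \<le> b t"
    and b_upper: "b t \<le> B"
begin

text \<open>\<open>K\<close> will bound the slopes of minimisers, and \<open>C\<close> the cost per unit of height of a ramp of
  slope \<open>K\<close> into a well. A sequence \<open>p\<close> stands for the function with value \<open>p i\<close> at time \<open>i / n\<close>.\<close>

definition K :: real where "K = B * D + 2"

definition C :: real where "C = K / 2 + B * D"

text \<open>The contribution of one cell of length \<open>1 / n\<close> to the action: half the
  squared velocity plus the weighted potential at the left endpoint. The weight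
  \<open>\<beta>\<close> is a parameter because translating a sequence turns \<open>b\<close> into a
  translate of \<open>b\<close>.\<close>

definition cell :: "(real \<Rightarrow> real) \<Rightarrow> nat \<Rightarrow> (int \<Rightarrow> real) \<Rightarrow> int \<Rightarrow> real" where
  "cell \<beta> n p i = n / 2 * (p (i + 1) - p i)\<^sup>2 + \<beta> (i / n) * V (p i) / n"

definition action :: "(real \<Rightarrow> real) \<Rightarrow> nat \<Rightarrow> (int \<Rightarrow> real) \<Rightarrow> int set \<Rightarrow> real" where
  "action \<beta> n p W = (\<Sum>i\<in>W. cell \<beta> n p i)"

definition admissible :: "int \<Rightarrow> (int \<Rightarrow> real) set" where
  "admissible N = {p. (\<forall>i. \<bar>p i\<bar> \<le> 1) \<and> (\<forall>i\<le>-N. p i = -1) \<and> (\<forall>i\<ge>N. p i = 1)}"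

text \<open>The condition \<open>int n \<le> N\<close> leaves one unit of time on either side of
  \<open>0\<close>, enough room for a ramp from \<open>0\<close> to a well and for a window of
  \<open>n\<close> cells inside the range.\<close>

definition minimizer :: "nat \<Rightarrow> int \<Rightarrow> (int \<Rightarrow> real) \<Rightarrow> bool" where
  "minimizer n N p \<longleftrightarrow> 1 \<le> n \<and> int n \<le> N \<and> p \<in> admissible N \<and>
     (\<forall>q\<in>admissible N. action b n p {-N..<N} \<le> action b n q {-N..<N})"

lemma b_pos: "b t > 0"
  using b0_pos b_lower[of t] by linarith

lemma B_pos: "B > 0"
  using b_pos[of 0] b_upper[of 0] by linarith

lemma D_nonneg: "D \<ge> 0"
  using V'_bound[of 0] by linarith

lemma K_ge: "K \<ge> 2"
  using B_pos D_nonneg by (simp add: K_def)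

lemma C_pos: "C > 0"
proof -
  have "B * D \<ge> 0" using B_pos D_nonneg by simp
  then show ?thesis using K_ge by (simp add: C_def)
qed

lemma cell_nonneg: "(\<And>t. 0 \<le> \<beta> t) \<Longrightarrow> cell \<beta> n p i \<ge> 0"
  by (simp add: cell_def V_nonneg)

text \<open>Mean value inequality on \<open>[-1, 1]\<close>, started at a well, where
  \<open>V\<close> vanishes.\<close>

lemma V_le:
  assumes "\<bar>x\<bar> \<le> 1"
  shows "V x \<le> D * (1 - x)" "V x \<le> D * (1 + x)"
proof -
  have lip: "\<bar>V x - V y\<bar> \<le> D * \<bar>x - y\<bar>" if "y \<in> {-1..1}" for y
  proof -
    have "norm (V x - V y) \<le> D * norm (x - y)"
    proof (rule field_differentiable_bound[of "{-1..1}" V V' D])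
      fix z :: real assume "z \<in> {-1..1}"
      then show "norm (V' z) \<le> D" using V'_bound[of z] by (simp add: abs_le_iff)
    qed (use assms that in \<open>auto intro: has_field_derivative_at_within[OF V_deriv]\<close>)
    then show ?thesis by simp
  qed
  show "V x \<le> D * (1 - x)" "V x \<le> D * (1 + x)"
    using lip[of 1] lip[of "-1"] V_zero V_nonneg[of x] assms by (auto simp: abs_le_iff add.commute)
qed

text \<open>On a linear ramp towards a well the cost telescopes.\<close>

lemma cell_ramp:
  assumes n: "n \<ge> 1" and \<beta>: "\<And>t. 0 \<le> \<beta> t" "\<And>t. \<beta> t \<le> B"
    and qi: "\<bar>q i\<bar> \<le> 1"
    and step: "0 \<le> q (i + 1) - q i" "q (i + 1) - q i \<le> K / n"
    and near: "(1 - q i) / n \<le> q (i + 1) - q i \<or> (1 + q i) / n \<le> q (i + 1) - q i"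
  shows "cell \<beta> n q i \<le> C * (q (i + 1) - q i)"
proof -
  define d where "d = q (i + 1) - q i"
  have "n / 2 * d\<^sup>2 \<le> n / 2 * (K / n * d)"
    using step unfolding d_def[symmetric]
    using mult_right_mono[of d "K / n" d] by (intro mult_left_mono) (auto simp: power2_eq_square)
  then have kin: "n / 2 * d\<^sup>2 \<le> K / 2 * d" using n by simp
  \<comment> \<open>By \<open>near\<close>, the step covers at least the fraction
    \<open>1 / n\<close> of the distance to one of the wells, and \<open>V\<close> is at most
    \<open>D\<close> times that distance. This gives the summand \<open>B * D\<close> of
    \<open>C\<close>; the kinetic part gives \<open>K / 2\<close>.\<close>
  have "V (q i) / n \<le> D * d"
  proof -
    have "V (q i) / n \<le> D * ((1 - q i) / n)" "V (q i) / n \<le> D * ((1 + q i) / n)"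
      using V_le[OF qi] n by (simp_all add: field_simps)
    then show ?thesis
      using near D_nonneg mult_left_mono[of "(1 - q i) / n" d D] mult_left_mono[of "(1 + q i) / n" d D]
      by (auto simp: d_def)
  qed
  then have "\<beta> (i / n) * (V (q i) / n) \<le> B * (D * d)"
    using \<beta> V_nonneg B_pos by (intro mult_mono) auto
  then show ?thesis
    using kin unfolding cell_def d_def[symmetric] C_def by (simp add: algebra_simps)
qed

text \<open>The basic competitor: \<open>p\<close> is kept on \<open>[j, k]\<close>, and ramps of
  slope \<open>K\<close> lead to \<open>-1\<close> on the left and to \<open>1\<close> on the right.
  Since \<open>K\<close> also bounds the slopes of minimisers, such a ramp reaches its well no
  farther out than a minimiser does.\<close>

definition trunc :: "nat \<Rightarrow> int \<Rightarrow> int \<Rightarrow> (int \<Rightarrow> real) \<Rightarrow> int \<Rightarrow> real" where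
  "trunc n j k p i =
     (if i < j then max (-1) (p j - K * (j - i) / n)
      else if i \<le> k then p i else min 1 (p k + K * (i - k) / n))"

lemma trunc_bound:
  assumes "\<And>i. \<bar>p i\<bar> \<le> 1"
  shows "\<bar>trunc n j k p i\<bar> \<le> 1"
proof -
  have "K * (j - i) / n \<ge> 0" if "i < j" using that K_ge by simp
  moreover have "K * (i - k) / n \<ge> 0" if "k < i" using that K_ge by simp
  ultimately show ?thesis
    using assms[of i] assms[of j] assms[of k] by (auto simp: trunc_def abs_le_iff)
qed

text \<open>As \<open>K \<ge> 2\<close>, a ramp covers the whole height \<open>2\<close> between the
  wells within \<open>n\<close> cells.\<close>

lemma trunc_far:
  assumes n: "n \<ge> 1" and p: "\<And>i. \<bar>p i\<bar> \<le> 1" and "j \<le> k"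
  shows "i \<le> j - int n \<Longrightarrow> trunc n j k p i = -1" "i \<ge> k + int n \<Longrightarrow> trunc n j k p i = 1"
proof -
  have *: "K * r / n \<ge> 2" if "r \<ge> n" for r :: real
  proof -
    have "K * r \<ge> 2 * real n" using that K_ge by (intro mult_mono) auto
    then show ?thesis using n by (simp add: field_simps)
  qed
  show "trunc n j k p i = -1" if "i \<le> j - int n"
    using *[of "j - i"] that p[of j] n by (auto simp: trunc_def)
  show "trunc n j k p i = 1" if "i \<ge> k + int n"
    using *[of "i - k"] that p[of k] n \<open>j \<le> k\<close> by (auto simp: trunc_def)
qed

text \<open>By \<open>cell_ramp\<close> a ramp cell costs at most \<open>C\<close> times its rise,
  so the cost of each ramp telescopes to \<open>C\<close> times its height, no matter how far the
  summation range extends.\<close>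

lemma action_trunc:
  assumes n: "n \<ge> 1" and \<beta>: "\<And>t. 0 \<le> \<beta> t" "\<And>t. \<beta> t \<le> B"
    and p: "\<And>i. \<bar>p i\<bar> \<le> 1" and jk: "w \<le> j" "j \<le> k" "k \<le> w'"
  shows "action \<beta> n (trunc n j k p) {w..<w'} \<le>
           action \<beta> n p {j..<k} + C * (1 + p j) + C * (1 - p k)"
proof -
  define q where "q = trunc n j k p"
  have qb: "\<bar>q i\<bar> \<le> 1" for i unfolding q_def by (rule trunc_bound[OF p])
  have Kn: "K / n > 0" using K_ge n by simp
  \<comment> \<open>These estimates verify the condition \<open>near\<close> of
    \<open>cell_ramp\<close>. A full step \<open>K / n\<close> suffices because
    \<open>K \<ge> 2\<close> exceeds any distance to a well. A clipped step starts in the well on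
    the left ramp and ends in it on the right ramp.\<close>
  have small: "x / n \<le> K / n" "x / n \<le> x" if "0 \<le> x" "x \<le> 2" for x :: real
    using that K_ge n mult_left_mono[of 1 "real n" x] by (auto simp: field_simps)
  have left: "cell \<beta> n q i \<le> C * (q (i + 1) - q i)" if "i < j" for i
  proof -
    have "q i = max (-1) (q (i + 1) - K / n)"
    proof -
      have "q (i + 1) = max (-1) (p j - K * (j - (i + 1)) / n)"
      proof (cases "i + 1 = j")
        case True
        then show ?thesis using p[of j] jk by (auto simp: q_def trunc_def)
      qed (use that in \<open>simp add: q_def trunc_def\<close>)
      moreover have "q i = max (-1) (p j - K * (j - i) / n)"
        using that by (auto simp: q_def trunc_def)
      moreover have "K * (j - i) / n = K * (j - (i + 1)) / n + K / n"
        by (simp add: algebra_simps add_divide_distrib diff_divide_distrib)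
      ultimately show ?thesis using Kn by (auto simp: max_def)
    qed
    then have "q (i + 1) - q i = min (1 + q (i + 1)) (K / n)" by auto
    then show ?thesis
      using qb[of i] qb[of "i + 1"] K_ge small[of "1 + q (i + 1)"] small[of "1 + q i"]
      by (intro cell_ramp[OF n \<beta>]) (auto simp: min_def divide_right_mono split: if_splits)
  qed
  have right: "cell \<beta> n q i \<le> C * (q (i + 1) - q i)" if "k \<le> i" for i
  proof -
    have "q (i + 1) = min 1 (q i + K / n)"
    proof -
      have "q i = min 1 (p k + K * (i - k) / n)"
      proof (cases "i = k")
        case True
        then show ?thesis using p[of k] jk by (auto simp: q_def trunc_def)
      qed (use that jk in \<open>simp add: q_def trunc_def\<close>)
      moreover have "q (i + 1) = min 1 (p k + K * (i + 1 - k) / n)"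
        using that jk by (auto simp: q_def trunc_def)
      moreover have "K * (i + 1 - k) / n = K * (i - k) / n + K / n"
        by (simp add: algebra_simps add_divide_distrib diff_divide_distrib)
      ultimately show ?thesis using Kn by (auto simp: min_def)
    qed
    then have "q (i + 1) - q i = min (1 - q i) (K / n)" by auto
    then show ?thesis
      using qb[of i] qb[of "i + 1"] K_ge small[of "1 - q i"]
      by (intro cell_ramp[OF n \<beta>]) (auto simp: min_def split: if_splits)
  qed
  have mid: "cell \<beta> n q i = cell \<beta> n p i" if "j \<le> i" "i < k" for i
    using that by (simp add: cell_def q_def trunc_def)
  have "action \<beta> n q {w..<w'} =
      (\<Sum>i\<in>{w..<j}. cell \<beta> n q i) + (\<Sum>i\<in>{j..<k}. cell \<beta> n q i) + (\<Sum>i\<in>{k..<w'}. cell \<beta> n q i)"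
    using jk by (simp add: action_def sum_int_split[of w j w'] sum_int_split[of j k w'])
  also have "\<dots> \<le> (\<Sum>i\<in>{w..<j}. C * (q (i + 1) - q i)) + action \<beta> n p {j..<k} + (\<Sum>i\<in>{k..<w'}. C * (q (i + 1) - q i))"
    unfolding action_def using left right mid by (intro add_mono sum_mono) auto
  also have "\<dots> = C * (q j - q w) + action \<beta> n p {j..<k} + C * (q w' - q k)"
    using jk by (simp add: sum_distrib_left[symmetric] sum_int_telescope)
  also have "\<dots> \<le> C * (1 + p j) + action \<beta> n p {j..<k} + C * (1 - p k)"
    using qb[of w] qb[of w'] C_pos jk
    by (intro add_mono mult_left_mono) (auto simp: abs_le_iff q_def trunc_def)
  finally show ?thesis by (simp add: q_def)
qed

section \<open>Existence of minimisers\<close>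

lemma cell_outside:
  assumes "p \<in> admissible N" "i \<notin> {-N..<N}"
  shows "cell \<beta> n p i = 0"
  using assms by (auto simp: admissible_def cell_def V_zero)

lemma action_le_admissible:
  assumes "p \<in> admissible N" "\<And>t. 0 \<le> \<beta> t" "finite W"
  shows "action \<beta> n p W \<le> action \<beta> n p {-N..<N}"
proof -
  have "action \<beta> n p W = action \<beta> n p (W \<inter> {-N..<N})"
    unfolding action_def using assms by (intro sum.mono_neutral_right) (auto intro: cell_outside)
  also have "\<dots> \<le> action \<beta> n p {-N..<N}"
    unfolding action_def by (intro sum_mono2) (auto intro: cell_nonneg assms)
  finally show ?thesis .
qed

text \<open>Admissible sequences form a product of points and compact intervals, hence a compact set
  in the product topology by Tychonoff, and the action is a continuous function of finitely many
  coordinates.\<close>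

lemma minimizer_exists:
  assumes "n \<ge> 1" "int n \<le> N"
  shows "\<exists>p. minimizer n N p"
proof -
  define S where "S i = (if i \<le> -N then {-1} else if i \<ge> N then {1} else {-1..1::real})" for i
  have adm: "admissible N = PiE UNIV S"
  proof (intro set_eqI iffI)
    fix p assume "p \<in> admissible N"
    then show "p \<in> PiE UNIV S"
      unfolding admissible_def S_def PiE_UNIV_domain Pi_def by (auto simp: abs_le_iff minus_le_iff)
  next
    fix p assume "p \<in> PiE UNIV S"
    then have p: "p i \<in> S i" for i by (auto simp: PiE_UNIV_domain)
    have "\<bar>p i\<bar> \<le> 1" for i using p[of i] by (auto simp: S_def split: if_splits)
    moreover have "p i = -1" if "i \<le> -N" for i using p[of i] that by (simp add: S_def)
    moreover have "p i = 1" if "i \<ge> N" for i using p[of i] that assms by (simp add: S_def)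
    ultimately show "p \<in> admissible N" by (simp add: admissible_def)
  qed
  have "compactin (product_topology (\<lambda>i. euclidean) UNIV) (PiE UNIV S)"
    by (subst compactin_PiE) (auto simp: S_def)
  then have "compact (admissible N)"
    by (simp add: adm euclidean_product_topology)
  moreover have "(\<lambda>i. if i \<ge> N then 1 else -1) \<in> admissible N"
    using assms by (auto simp: admissible_def)
  moreover have "continuous_on (admissible N) (\<lambda>p. action b n p {-N..<N})"
  proof -
    have coord: "continuous_on (admissible N) (\<lambda>p. p i)" for i :: int
      by (rule continuous_on_subset[OF continuous_on_product_coordinates]) auto
    have "continuous_on UNIV V"
      using V_deriv by (intro continuous_at_imp_continuous_on ballI DERIV_isCont) auto
    then have "continuous_on (admissible N) (\<lambda>p. V (p i))" for i
      by (rule continuous_on_compose2[OF _ coord]) auto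
    then show ?thesis
      unfolding action_def cell_def divide_inverse by (intro continuous_intros coord)
  qed
  ultimately obtain p where "p \<in> admissible N"
      "\<forall>q\<in>admissible N. action b n p {-N..<N} \<le> action b n q {-N..<N}"
    using continuous_attains_inf[of "admissible N" "\<lambda>p. action b n p {-N..<N}"] by blast
  then show ?thesis using assms by (auto simp: minimizer_def)
qed

end

section \<open>Properties of minimisers\<close>

text \<open>A step of size at most \<open>2 * c\<close> cannot jump over the interval
  \<open>[-c, c]\<close>.\<close>

lemma int_intermediate_value:
  fixes p :: "int \<Rightarrow> real"
  assumes "i \<le> m" "p i < - c" "p m \<ge> - c" and step: "\<And>j. \<bar>p (j + 1) - p j\<bar> \<le> 2 * c"
  shows "\<exists>j. i \<le> j \<and> j \<le> m \<and> \<bar>p j\<bar> \<le> c"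
  using assms(1,3)
proof (induction m rule: int_ge_induct)
  case base
  then show ?case using assms(2) by simp
next
  case (step m)
  show ?case
  proof (cases "p m \<ge> - c")
    case True
    then show ?thesis using step.IH by fastforce
  next
    case False
    then have "\<bar>p (m + 1)\<bar> \<le> c" using step.prems assms(4)[of m] by linarith
    then show ?thesis using step.hyps by (intro exI[of _ "m + 1"]) auto
  qed
qed

context double_well
begin

section \<open>Discrete Euler-Lagrange equation and uniform bounds\<close>

lemma minimizerD:
  assumes "minimizer n N p"
  shows "n \<ge> 1" "int n \<le> N" "p \<in> admissible N" "\<bar>p i\<bar> \<le> 1"
    "i \<le> -N \<Longrightarrow> p i = -1" "N \<le> i \<Longrightarrow> p i = 1"
    "q \<in> admissible N \<Longrightarrow> action b n p {-N..<N} \<le> action b n q {-N..<N}"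
  using assms by (auto simp: minimizer_def admissible_def)

text \<open>Values outside \<open>[-1, 1]\<close> are never better, since clamping decreases both energies;
  hence the minimizer is critical even where the constraint is active.\<close>

lemma minimizer_equation:
  assumes min: "minimizer n N p" and i: "\<bar>i\<bar> < N"
  shows "n * (p (i + 1) - 2 * p i + p (i - 1)) = b (i / n) * V' (p i) / n"
proof -
  note m = minimizerD[OF min]
  \<comment> \<open>Only the cells \<open>i - 1\<close> and \<open>i\<close> involve the value at
    \<open>i\<close>; \<open>g\<close> is their sum as a function of this value, up to a term that
    does not depend on it.\<close>
  define g where "g y = n / 2 * (y - p (i - 1))\<^sup>2 + n / 2 * (p (i + 1) - y)\<^sup>2 + b (i / n) * V y / n" for y
  have split: "action b n q {-N..<N} =
      cell b n q (i - 1) + cell b n q i + action b n q ({-N..<N} - {i - 1, i})" for q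
  proof -
    have "{-N..<N} = {i - 1, i} \<union> ({-N..<N} - {i - 1, i})" using i by auto
    then have "action b n q {-N..<N} = action b n q ({i - 1, i} \<union> ({-N..<N} - {i - 1, i}))" by simp
    also have "\<dots> = action b n q {i - 1, i} + action b n q ({-N..<N} - {i - 1, i})"
      unfolding action_def by (intro sum.union_disjoint) auto
    finally show ?thesis by (simp add: action_def)
  qed
  have in_range: "g (p i) \<le> g y" if y: "\<bar>y\<bar> \<le> 1" for y
  proof -
    have "p(i := y) \<in> admissible N"
      using y i m(3) by (auto simp: admissible_def)
    then have "action b n p {-N..<N} \<le> action b n (p(i := y)) {-N..<N}" by (rule m(7))
    moreover have "action b n (p(i := y)) ({-N..<N} - {i - 1, i}) = action b n p ({-N..<N} - {i - 1, i})"
      unfolding action_def by (intro sum.cong) (auto simp: cell_def)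
    ultimately show ?thesis
      unfolding split by (simp add: cell_def g_def)
  qed
  have "g (p i) \<le> g y" for y
  proof (cases "\<bar>y\<bar> \<le> 1")
    case False
    define z :: real where "z = (if y > 1 then 1 else -1)"
    have "g (p i) \<le> g z" by (rule in_range) (simp add: z_def)
    also have "g z \<le> g y"
    proof -
      have sq: "(z - x)\<^sup>2 \<le> (y - x)\<^sup>2" "(x - z)\<^sup>2 \<le> (x - y)\<^sup>2" if "\<bar>x\<bar> \<le> 1" for x
        using that False
        by (auto simp: z_def abs_le_iff power2_commute[of x] intro!: power_mono
            power2_le_iff_abs_le[THEN iffD2] abs_le_square_iff[THEN iffD1])
      have "V z \<le> V y" using V_zero V_nonneg by (simp add: z_def)
      then show ?thesis
        unfolding g_def using sq m(4) b_pos[of "i / n"]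
        by (intro add_mono mult_left_mono divide_right_mono) auto
    qed
    finally show ?thesis .
  qed (rule in_range)
  moreover have "(g has_real_derivative
      n * (p i - p (i - 1)) - n * (p (i + 1) - p i) + b (i / n) * V' (p i) / n) (at (p i))"
    unfolding g_def using m(1) by (auto intro!: derivative_eq_intros V_deriv simp: field_simps)
  ultimately have "n * (p i - p (i - 1)) - n * (p (i + 1) - p i) + b (i / n) * V' (p i) / n = 0"
    by (intro DERIV_local_min[of g _ "p i" 1]) auto
  then show ?thesis by (simp add: algebra_simps)
qed

lemma minimizer_second_difference:
  assumes min: "minimizer n N p" and i: "\<bar>i\<bar> < N"
  shows "\<bar>p (i + 1) - 2 * p i + p (i - 1)\<bar> \<le> B * D / (real n)\<^sup>2"
proof -
  note m = minimizerD[OF min]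
  have "\<bar>b (i / n) * V' (p i)\<bar> \<le> B * D"
    using b_pos[of "i / n"] b_upper[of "i / n"] V'_bound[OF m(4), of i] B_pos
    unfolding abs_mult by (intro mult_mono) auto
  moreover have "p (i + 1) - 2 * p i + p (i - 1) = b (i / n) * V' (p i) / (real n)\<^sup>2"
    using minimizer_equation[OF assms] m(1) by (simp add: field_simps power2_eq_square)
  ultimately show ?thesis by (simp add: divide_right_mono)
qed

text \<open>\<open>discrete_slope_bound\<close> with \<open>M = B * D\<close>, which is where
  \<open>K = B * D + 2\<close> comes from. The window starts at \<open>i\<close> unless it would
  leave \<open>[-N, N]\<close>, in which case it is moved left to end at \<open>N\<close>.\<close>

lemma minimizer_step:
  assumes min: "minimizer n N p"
  shows "\<bar>p (i + 1) - p i\<bar> \<le> K / n"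
proof (cases "-N \<le> i \<and> i < N")
  case True
  note m = minimizerD[OF min]
  define w where "w = min i (N - int n)"
  show ?thesis
    unfolding K_def
    by (rule discrete_slope_bound[of n w])
      (use True m B_pos D_nonneg in \<open>auto simp: w_def intro!: minimizer_second_difference[OF min]\<close>)
next
  case False
  then have "p (i + 1) = p i" using minimizerD(5,6)[OF min] by auto
  then show ?thesis using K_ge by simp
qed

lemma minimizer_Lipschitz:
  assumes "minimizer n N p"
  shows "\<bar>p j - p i\<bar> \<le> K * \<bar>real_of_int (j - i)\<bar> / n"
  using int_Lipschitz_of_steps[of p "K / n" j i] minimizer_step[OF assms] by simp

text \<open>The competitor is a pair of ramps meeting with value \<open>0\<close> at time
  \<open>0\<close>; each has height \<open>1\<close> and costs at most \<open>C\<close>,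
  independently of \<open>n\<close> and \<open>N\<close>.\<close>

lemma minimizer_action_le:
  assumes min: "minimizer n N p" and "finite W"
  shows "action b n p W \<le> 2 * C"
proof -
  note m = minimizerD[OF min]
  have nonneg: "0 \<le> b t" for t using b_pos[of t] by simp
  define q where "q = trunc n 0 0 (\<lambda>_. 0)"
  have "q \<in> admissible N"
    using m(1,2) trunc_bound[of "\<lambda>_. 0" n 0 0] trunc_far[of n "\<lambda>_. 0" 0 0]
    by (auto simp: admissible_def q_def)
  then have "action b n p {-N..<N} \<le> action b n q {-N..<N}" by (rule m(7))
  also have "\<dots> \<le> action b n (\<lambda>_. 0) {0..<0} + C * (1 + 0) + C * (1 - 0)"
    unfolding q_def using m(1,2) nonneg b_upper by (intro action_trunc) auto
  also have "\<dots> = 2 * C" by (simp add: action_def)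
  finally show ?thesis using action_le_admissible[OF m(3) nonneg \<open>finite W\<close>] by (meson order_trans)
qed

text \<open>Replacing \<open>p\<close> outside \<open>[j, k]\<close> by ramps gives an admissible
  competitor, so whatever \<open>p\<close> spends outside that interval is at most the cost of the
  ramps.\<close>

lemma minimizer_cut:
  assumes min: "minimizer n N p" and jk: "j \<le> k" "p j < 1" "p k > -1"
    and W: "finite W" "W \<inter> {j..<k} = {}"
  shows "action b n p W \<le> C * (1 + p j) + C * (1 - p k)"
proof -
  note m = minimizerD[OF min]
  have nonneg: "0 \<le> b t" for t using b_pos[of t] by simp
  define q where "q = trunc n j k p"
  \<comment> \<open>With these inequalities and the Lipschitz bound, both ramps have reached their
    wells by \<open>-N\<close> and \<open>N\<close>, so the competitor keeps the boundary
    values.\<close>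
  have "j < N" "-N < k" using m(5,6) jk by (metis less_irrefl not_le)+
  have "q i = -1" if "i \<le> -N" for i
    using minimizer_Lipschitz[OF min, of j i] m(5)[OF that] that \<open>-N < k\<close>
    by (auto simp: q_def trunc_def abs_le_iff)
  moreover have "q i = 1" if "N \<le> i" for i
    using minimizer_Lipschitz[OF min, of i k] m(6)[OF that] that \<open>j < N\<close>
    by (auto simp: q_def trunc_def abs_le_iff)
  moreover have "\<bar>q i\<bar> \<le> 1" for i unfolding q_def by (rule trunc_bound[OF m(4)])
  ultimately have "q \<in> admissible N" by (simp add: admissible_def)
  have "action b n p W + action b n p {j..<k} = action b n p (W \<union> {j..<k})"
    unfolding action_def using W by (intro sum.union_disjoint[symmetric]) auto
  also have "\<dots> \<le> action b n p {-N..<N}"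
    using W by (intro action_le_admissible m nonneg) auto
  also have "\<dots> \<le> action b n q {-N..<N}" using \<open>q \<in> admissible N\<close> by (rule m(7))
  \<comment> \<open>The range is enlarged because \<open>[j, k]\<close> may stick out of
    \<open>[-N, N]\<close>, while \<open>action_trunc\<close> needs a range that contains
    it.\<close>
  also have "\<dots> \<le> action b n q {min (-N) j..<max N k}"
    unfolding action_def by (intro sum_mono2) (auto intro: cell_nonneg nonneg)
  also have "\<dots> \<le> action b n p {j..<k} + C * (1 + p j) + C * (1 - p k)"
    unfolding q_def using m nonneg b_upper jk by (intro action_trunc) auto
  finally show ?thesis by simp
qed

section \<open>Energy estimates: the cost of staying away from the wells\<close>

lemma V_lower_bound:
  assumes "0 < \<delta>"
  shows "\<exists>\<mu>>0. \<forall>x. \<bar>x\<bar> \<le> 1 - \<delta> \<longrightarrow> \<mu> \<le> V x"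
proof (cases "\<delta> \<le> 1")
  case True
  have "continuous_on {-(1 - \<delta>)..1 - \<delta>} V"
    using V_deriv by (intro continuous_at_imp_continuous_on ballI DERIV_isCont) auto
  then obtain z where z: "z \<in> {-(1 - \<delta>)..1 - \<delta>}" "\<forall>x\<in>{-(1 - \<delta>)..1 - \<delta>}. V z \<le> V x"
    using continuous_attains_inf[of "{-(1 - \<delta>)..1 - \<delta>}" V] True by auto
  moreover have "V z > 0" using z assms by (intro V_pos) auto
  ultimately show ?thesis by (intro exI[of _ "V z"]) (auto simp: abs_le_iff)
next
  case False
  then show ?thesis by (intro exI[of _ 1]) auto
qed

lemma cell_lower:
  assumes "\<mu> \<le> V (p i)"
  shows "b0 * \<mu> / n \<le> cell b n p i"
proof -
  have "b0 * \<mu> \<le> b (i / n) * V (p i)"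
    using assms b0_pos b_lower V_nonneg[of "p i"] mult_left_mono[of \<mu> "V (p i)" b0]
      mult_right_mono[of b0 "b (i / n)" "V (p i)"] by (smt (verit))
  then have "b0 * \<mu> / n \<le> b (i / n) * V (p i) / n" by (simp add: divide_right_mono)
  then show ?thesis by (simp add: cell_def add_increasing)
qed

text \<open>With slopes bounded by \<open>K\<close>, a change by \<open>\<delta> / 2\<close> takes
  at least time \<open>\<delta> / (2 * K)\<close>; the floor is the corresponding number of
  cells.\<close>

lemma minimizer_near:
  assumes min: "minimizer n N p" and i: "\<bar>p i\<bar> \<le> 1 - \<delta>"
    and j: "i \<le> j" "j \<le> i + \<lfloor>\<delta> / (2 * K) * n\<rfloor>"
  shows "\<bar>p j\<bar> \<le> 1 - \<delta> / 2"
proof -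
  have n: "n \<ge> 1" by (rule minimizerD[OF min])
  have "real_of_int (j - i) \<le> \<delta> / (2 * K) * n" using j by linarith
  then have "K * real_of_int (j - i) \<le> K * (\<delta> / (2 * K) * n)" using K_ge by (intro mult_left_mono) auto
  also have "\<dots> = \<delta> / 2 * n" using K_ge by simp
  finally have "K * real_of_int (j - i) / n \<le> \<delta> / 2" using n by (simp add: divide_simps)
  moreover have "\<bar>real_of_int (j - i)\<bar> = real_of_int (j - i)" using j by simp
  ultimately show ?thesis using minimizer_Lipschitz[OF min, of j i] i by (simp only:)
qed

text \<open>By \<open>minimizer_near\<close> a minimiser stays away from the wells for a fixed time
  after \<open>i\<close>, where \<open>V\<close> has a positive lower bound. The resulting cost does
  not depend on \<open>n\<close>.\<close>

lemma minimizer_dwell: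
  assumes "0 < \<delta>"
  shows "\<exists>c>0. \<forall>n N p i. minimizer n N p \<longrightarrow> \<bar>p i\<bar> \<le> 1 - \<delta> \<longrightarrow>
           c \<le> action b n p {i..i + \<lfloor>\<delta> / (2 * K) * n\<rfloor>}"
proof -
  obtain \<mu> where \<mu>: "\<mu> > 0" "\<And>x. \<bar>x\<bar> \<le> 1 - \<delta> / 2 \<Longrightarrow> \<mu> \<le> V x"
    using V_lower_bound[of "\<delta> / 2"] assms by auto
  define d where "d = \<delta> / (2 * K)"
  have d: "d > 0" using assms K_ge by (simp add: d_def)
  have "d * (b0 * \<mu>) \<le> action b n p {i..i + \<lfloor>d * n\<rfloor>}"
    if min: "minimizer n N p" and i: "\<bar>p i\<bar> \<le> 1 - \<delta>" for n N p i
  proof -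
    have n: "n \<ge> 1" by (rule minimizerD[OF min])
    have "d * n \<ge> 0" using d by simp
    \<comment> \<open>The interval is closed, so it has one element more than the floor and hence at
      least \<open>d * n\<close> elements.\<close>
    then have card: "d * n \<le> card {i..i + \<lfloor>d * n\<rfloor>}" by simp
    have "d * (b0 * \<mu>) = d * n * (b0 * \<mu> / n)" using n by simp
    also have "\<dots> \<le> card {i..i + \<lfloor>d * n\<rfloor>} * (b0 * \<mu> / n)"
      using card \<mu> b0_pos by (intro mult_right_mono) auto
    also have "\<dots> = (\<Sum>j\<in>{i..i + \<lfloor>d * n\<rfloor>}. b0 * \<mu> / n)" by simp
    also have "\<dots> \<le> action b n p {i..i + \<lfloor>d * n\<rfloor>}"
      unfolding action_def
      by (intro sum_mono cell_lower \<mu>(2) minimizer_near[OF min i]) (auto simp: d_def)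
    finally show ?thesis .
  qed
  moreover have "d * (b0 * \<mu>) > 0" using d \<mu> b0_pos by simp
  ultimately show ?thesis unfolding d_def by blast
qed

text \<open>An excursion outside \<open>[j, k]\<close> would cost at least the dwelling cost
  \<open>c\<close>, whereas by \<open>minimizer_cut\<close> everything outside costs at most
  \<open>2 * C * \<theta>\<close>.\<close>

lemma minimizer_trapped:
  assumes "0 < \<delta>"
  shows "\<exists>\<theta>>0. \<theta> < 1 \<and> (\<forall>n N p i j k. minimizer n N p \<longrightarrow> j \<le> k \<longrightarrow> p j \<le> -1 + \<theta> \<longrightarrow> 1 - \<theta> \<le> p k \<longrightarrow>
           \<bar>p i\<bar> \<le> 1 - \<delta> \<longrightarrow> j \<le> i \<and> i \<le> k)"
proof -
  obtain c where c: "c > 0" and dwell: "\<And>n N p i. minimizer n N p \<Longrightarrow> \<bar>p i\<bar> \<le> 1 - \<delta> \<Longrightarrow>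
           c \<le> action b n p {i..i + \<lfloor>\<delta> / (2 * K) * n\<rfloor>}"
    using minimizer_dwell[OF assms] by blast
  \<comment> \<open>The bound \<open>c / (4 * C)\<close> makes the two ramps cheaper than
    \<open>c\<close>. The bound \<open>\<delta> / 4\<close> puts \<open>p j\<close> and
    \<open>p k\<close> closer to the wells than any value in the dwelling window, so neither
    \<open>j\<close> nor \<open>k\<close> lies in that window.\<close>
  define \<theta> where "\<theta> = min (1 / 2) (min (\<delta> / 4) (c / (4 * C)))"
  have \<theta>: "\<theta> > 0" "\<theta> < 1" "\<theta> < \<delta> / 2" using c C_pos assms by (auto simp: \<theta>_def)
  have "C * \<theta> \<le> C * (c / (4 * C))" using C_pos by (intro mult_left_mono) (auto simp: \<theta>_def)
  then have C\<theta>: "C * \<theta> \<le> c / 4" using C_pos by simp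
  have "j \<le> i \<and> i \<le> k"
    if min: "minimizer n N p" and jk: "j \<le> k" "p j \<le> -1 + \<theta>" "1 - \<theta> \<le> p k"
      and i: "\<bar>p i\<bar> \<le> 1 - \<delta>" for n N p i j k
  proof (rule ccontr)
    define W where "W = {i..i + \<lfloor>\<delta> / (2 * K) * n\<rfloor>}"
    have near: "\<bar>p l\<bar> \<le> 1 - \<delta> / 2" if "l \<in> W" for l
      using that minimizer_near[OF min i] by (auto simp: W_def)
    have "j \<notin> W" "k \<notin> W" using near[of j] near[of k] jk \<theta> by fastforce+
    moreover assume "\<not> (j \<le> i \<and> i \<le> k)"
    ultimately have "W \<inter> {j..<k} = {}" using jk by (auto simp: W_def)
    then have "action b n p W \<le> C * (1 + p j) + C * (1 - p k)"
      using jk \<theta> by (intro minimizer_cut[OF min]) (auto simp: W_def)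
    also have "\<dots> \<le> C * \<theta> + C * \<theta>"
      using jk C_pos by (intro add_mono mult_left_mono) auto
    also have "\<dots> < c" using C\<theta> c by linarith
    finally show False using dwell[OF min i] by (simp add: W_def)
  qed
  then show ?thesis using \<theta> by blast
qed

text \<open>Staying at distance at least \<open>\<theta>\<close> from the wells for \<open>L\<close>
  units of time costs at least \<open>L * (b0 * \<mu>)\<close>, which exceeds the action bound
  \<open>2 * C\<close> for large \<open>L\<close>.\<close>

lemma minimizer_leaves:
  assumes "0 < \<theta>"
  shows "\<exists>L::nat. \<forall>n N p i. minimizer n N p \<longrightarrow>
           (\<exists>m. i \<le> m \<and> m \<le> i + int (L * n) \<and> \<bar>p m\<bar> > 1 - \<theta>)"
proof -
  obtain \<mu> where \<mu>: "\<mu> > 0" "\<And>x. \<bar>x\<bar> \<le> 1 - \<theta> \<Longrightarrow> \<mu> \<le> V x"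
    using V_lower_bound[OF assms] by auto
  have pos: "b0 * \<mu> > 0" using \<mu> b0_pos by simp
  obtain L :: nat where L: "2 * C < L * (b0 * \<mu>)"
    using reals_Archimedean3[OF pos] by blast
  have "\<exists>m. i \<le> m \<and> m \<le> i + int (L * n) \<and> \<bar>p m\<bar> > 1 - \<theta>"
    if min: "minimizer n N p" for n N p i
  proof (rule ccontr)
    assume *: "\<not> ?thesis"
    have n: "n \<ge> 1" by (rule minimizerD[OF min])
    have "L * (b0 * \<mu>) = (\<Sum>j\<in>{i..<i + int (L * n)}. b0 * \<mu> / n)" using n by simp
    also have "\<dots> \<le> action b n p {i..<i + int (L * n)}"
      unfolding action_def using * by (intro sum_mono cell_lower \<mu>(2)) (auto simp: not_less)
    also have "\<dots> \<le> 2 * C" by (rule minimizer_action_le[OF min]) auto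
    finally show False using L by simp
  qed
  then show ?thesis by blast
qed

text \<open>Going forwards and backwards from a middle value, \<open>minimizer_leaves\<close> finds
  points close to some well within bounded time; \<open>minimizer_trapped\<close> decides which well
  it is.\<close>

lemma minimizer_window:
  assumes "0 < \<theta>"
  shows "\<exists>L::nat. \<forall>n N p i. minimizer n N p \<longrightarrow> \<bar>p i\<bar> \<le> 1 / 2 \<longrightarrow>
           (\<exists>j k. i - int (L * n) \<le> j \<and> j \<le> i \<and> i \<le> k \<and> k \<le> i + int (L * n) \<and>
              p j \<le> -1 + \<theta> \<and> 1 - \<theta> \<le> p k)"
proof -
  obtain \<theta>0 where \<theta>0: "\<theta>0 > 0" and trap: "\<And>n N p i j k. minimizer n N p \<Longrightarrow> j \<le> k \<Longrightarrow>
      p j \<le> -1 + \<theta>0 \<Longrightarrow> 1 - \<theta>0 \<le> p k \<Longrightarrow> \<bar>p i\<bar> \<le> 1 - 1 / 2 \<Longrightarrow> j \<le> i \<and> i \<le> k"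
    using minimizer_trapped[OF half_gt_zero[OF zero_less_one]] by blast
  define t where "t = min (1 / 2) (min \<theta> \<theta>0)"
  have t: "t > 0" "t \<le> 1 / 2" "t \<le> \<theta>" "t \<le> \<theta>0" using assms \<theta>0 by (auto simp: t_def)
  obtain L :: nat where L: "\<And>n N p i. minimizer n N p \<Longrightarrow>
           \<exists>m. i \<le> m \<and> m \<le> i + int (L * n) \<and> \<bar>p m\<bar> > 1 - t"
    using minimizer_leaves[OF t(1)] by blast
  have "\<exists>j k. i - int (L * n) \<le> j \<and> j \<le> i \<and> i \<le> k \<and> k \<le> i + int (L * n) \<and>
              p j \<le> -1 + \<theta> \<and> 1 - \<theta> \<le> p k"
    if min: "minimizer n N p" and i: "\<bar>p i\<bar> \<le> 1 / 2" for n N p i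
  proof -
    note m = minimizerD[OF min]
    obtain k where k: "i \<le> k" "k \<le> i + int (L * n)" "\<bar>p k\<bar> > 1 - t" using L[OF min] by blast
    have "p k > 1 - t"
    proof (rule ccontr)
      assume "\<not> p k > 1 - t"
      then have "p k \<le> -1 + \<theta>0" using k t by (auto simp: abs_if split: if_splits)
      \<comment> \<open>If \<open>p k\<close> were close to \<open>-1\<close>, the pair
        \<open>k\<close>, \<open>max N k\<close> would trap the middle value at \<open>i\<close> to
        the right of \<open>k\<close>. Together with \<open>i \<le> k\<close> this forces
        \<open>i = k\<close>, but \<open>\<bar>p k\<bar> > 1 / 2\<close>. The left side is
        symmetric.\<close>
      then have "k \<le> i"
        using trap[OF min, of k "max N k" i] m(6)[of "max N k"] \<theta>0 i by auto
      then show False using k i t by auto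
    qed
    obtain j where j: "i - int (L * n) \<le> j" "j \<le> i" "\<bar>p j\<bar> > 1 - t"
      using L[OF min, of "i - int (L * n)"] by auto
    have "p j < -1 + t"
    proof (rule ccontr)
      assume "\<not> p j < -1 + t"
      then have "1 - \<theta>0 \<le> p j" using j t by (auto simp: abs_if split: if_splits)
      then have "i \<le> j"
        using trap[OF min, of "min (-N) j" j i] m(5)[of "min (-N) j"] \<theta>0 i by auto
      then show False using j i t by auto
    qed
    then show ?thesis using j k \<open>p k > 1 - t\<close> t by (intro exI[of _ j] exI[of _ k]) auto
  qed
  then show ?thesis by blast
qed

text \<open>For \<open>n \<ge> K\<close> a single step is at most \<open>1\<close>, which is at most
  \<open>2 * c\<close>.\<close>

lemma minimizer_crosses:
  assumes min: "minimizer n N p" and "1 / 2 \<le> c" "K \<le> n" "i \<le> m" "p i < - c" "- c \<le> p m"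
  shows "\<exists>j. i \<le> j \<and> j \<le> m \<and> \<bar>p j\<bar> \<le> c"
proof (rule int_intermediate_value)
  fix j
  have "K / n \<le> 1" using assms(3) K_ge by simp
  then show "\<bar>p (j + 1) - p j\<bar> \<le> 2 * c"
    using minimizer_step[OF min, of j] assms(2) by linarith
qed (use assms in auto)

end

section \<open>Localisation of the transition\<close>

lemma unit_periodic_shift:
  fixes f :: "real \<Rightarrow> real"
  assumes "\<And>t. f (t + 1) = f t"
  shows "f (t - of_int k) = f t"
proof -
  have *: "f (t - of_nat m) = f t" for t m
  proof (induction m)
    case (Suc m)
    then show ?case using assms[of "t - of_nat (Suc m)"] by (simp add: algebra_simps)
  qed simp
  show ?thesis
    using *[of t "nat k"] *[of "t - of_int k" "nat (- k)"] by (cases "k \<ge> 0") auto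
qed

text \<open>With the period normalised to \<open>1\<close>, a translation by whole periods moves a
  sequence by a multiple of \<open>n\<close> grid points and so stays on the grid.\<close>

locale asymptotically_periodic_well = double_well +
  fixes bP :: "real \<Rightarrow> real"
  assumes b_cont: "continuous_on UNIV b"
    and bP_cont: "continuous_on UNIV bP"
    and bP_periodic: "bP (t + 1) = bP t"
    and b_less: "b t < bP t"
    and b_asymp: "((\<lambda>t. \<bar>b t - bP t\<bar>) \<longlongrightarrow> 0) at_infinity"
begin

lemma bP_shift: "bP (t - of_int k) = bP t"
  by (rule unit_periodic_shift) (rule bP_periodic)

text \<open>Compactness turns \<open>b < bP\<close> into a uniform gap. The interval has length
  \<open>2\<close> because a transition point is moved back into \<open>[0, 1)\<close> and the cells
  that follow it over at most one further unit of time are used.\<close>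

lemma gap_lower_bound: "\<exists>g>0. \<forall>s\<in>{0..2}. g \<le> bP s - b s"
proof -
  have "continuous_on {0..2} (\<lambda>s. bP s - b s)"
    by (intro continuous_intros) (auto intro: continuous_on_subset[OF b_cont] continuous_on_subset[OF bP_cont])
  then obtain z where "z \<in> {0..2}" "\<forall>s\<in>{0..2}. bP z - b z \<le> bP s - b s"
    using continuous_attains_inf[of "{0..2}" "\<lambda>s. bP s - b s"] by auto
  then show ?thesis using b_less[of z] by (intro exI[of _ "bP z - b z"]) auto
qed

text \<open>A transition located far away may be moved back by an integer number of periods; there the
  potential is smaller than \<open>bP\<close> by a definite amount, whereas far away it is almost \<open>bP\<close>.\<close>

lemma transition_bounded:
  "\<exists>(R::nat) (n0::nat). \<forall>n N p i. n0 \<le> n \<longrightarrow> int n * int n \<le> N \<longrightarrow> minimizer n N p \<longrightarrow>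
     \<bar>p i\<bar> \<le> 1 / 2 \<longrightarrow> \<bar>i\<bar> \<le> int (R * n)"
proof -
  obtain \<mu> where \<mu>: "\<mu> > 0" "\<And>x. \<bar>x\<bar> \<le> 1 - 1 / 4 \<Longrightarrow> \<mu> \<le> V x"
    using V_lower_bound[of "1 / 4"] by auto
  obtain g where g: "g > 0" "\<And>s. 0 \<le> s \<Longrightarrow> s \<le> 2 \<Longrightarrow> g \<le> bP s - b s"
    using gap_lower_bound by auto
  define d where "d = (1 / 2) / (2 * K)"
  have d: "d > 0" "d \<le> 1" using K_ge by (auto simp: d_def field_simps)
  \<comment> \<open>\<open>\<eta>\<close> is the guaranteed gain of the translation: time
    \<open>d\<close> spent at middle values, coefficient gap \<open>g\<close>, potential at least
    \<open>\<mu>\<close>. Below, \<open>\<theta>\<close> keeps the ramps within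
    \<open>\<eta> / 4\<close>, and \<open>e\<close> keeps the error from \<open>b\<close> differing
    from \<open>bP\<close> far out within \<open>\<eta> / 2\<close>. The total stays below
    \<open>\<eta>\<close>.\<close>
  define \<eta> where "\<eta> = d * (g * \<mu>)"
  have \<eta>: "\<eta> > 0" using d g \<mu> by (simp add: \<eta>_def)
  define \<theta> where "\<theta> = min (1 / 8) (\<eta> / (8 * C))"
  have \<theta>: "\<theta> > 0" "\<theta> \<le> 1 / 8" using \<eta> C_pos by (auto simp: \<theta>_def)
  have "C * \<theta> \<le> C * (\<eta> / (8 * C))" using C_pos by (intro mult_left_mono) (auto simp: \<theta>_def)
  then have C\<theta>: "C * \<theta> \<le> \<eta> / 8" using C_pos by simp
  obtain L :: nat where L: "\<And>n N p i. minimizer n N p \<Longrightarrow> \<bar>p i\<bar> \<le> 1 / 2 \<Longrightarrow>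
      \<exists>j k. i - int (L * n) \<le> j \<and> j \<le> i \<and> i \<le> k \<and> k \<le> i + int (L * n) \<and>
            p j \<le> -1 + \<theta> \<and> 1 - \<theta> \<le> p k"
    using minimizer_window[OF \<theta>(1)] by blast
  define e where "e = \<eta> / (8 * (real L + 1) * (D + 1))"
  have e: "e > 0" using \<eta> D_nonneg by (simp add: e_def)
  have eL: "2 * real L * (e * (2 * D)) \<le> \<eta> / 2"
  proof -
    have "real L * D \<le> (real L + 1) * (D + 1)" using D_nonneg by (simp add: algebra_simps)
    then have "4 * e * (real L * D) \<le> 4 * e * ((real L + 1) * (D + 1))" using e by (intro mult_left_mono) auto
    also have "\<dots> = \<eta> / 2" using D_nonneg unfolding e_def by (simp add: divide_simps)
    finally show ?thesis by (simp add: algebra_simps)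
  qed
  obtain R0 where R0: "\<And>s. R0 \<le> \<bar>s\<bar> \<Longrightarrow> \<bar>b s - bP s\<bar> < e"
    using tendstoD[OF b_asymp e] by (auto simp: eventually_at_infinity dist_real_def)
  obtain R1 :: nat where R1: "R0 \<le> R1" using real_arch_simple by blast
  \<comment> \<open>The transition extends at most time \<open>L\<close> to either side of
    \<open>i\<close>, so all of it lies where \<open>b\<close> and \<open>bP\<close> differ by less
    than \<open>e\<close>.\<close>
  define R where "R = L + R1"
  have "\<bar>i\<bar> \<le> int (R * n)"
    if n0: "L + 2 \<le> n" and N: "int n * int n \<le> N" and min: "minimizer n N p" and i: "\<bar>p i\<bar> \<le> 1 / 2"
    for n N p i
  proof (rule ccontr)
    assume far: "\<not> \<bar>i\<bar> \<le> int (R * n)"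
    note m = minimizerD[OF min]
    obtain j k where jk: "i - int (L * n) \<le> j" "j \<le> i" "i \<le> k" "k \<le> i + int (L * n)"
      "p j \<le> -1 + \<theta>" "1 - \<theta> \<le> p k" using L[OF min i] by blast
    \<comment> \<open>The number of whole periods by which to move back: the grid point
      \<open>i\<close> goes to a time in \<open>[0, 1)\<close>.\<close>
    define s where "s = i div int n"
    define \<beta> where "\<beta> t = b (t - of_int s)" for t
    have si: "s * int n \<le> i" "i < (s + 1) * int n"
      using m(1) div_mult_mod_eq[of i "int n"] pos_mod_bound[of "int n" i] pos_mod_sign[of "int n" i]
      unfolding s_def distrib_right by linarith+
    define q where "q = trunc n j k p"
    define q' where "q' l = q (l + s * int n)" for l
    \<comment> \<open>Room for the translated competitor: \<open>L\<close> units of time for the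
      transition, one for the offset of \<open>i\<close> within its period and one for a
      ramp.\<close>
    have LN: "int (L * n) + 2 * int n \<le> N"
    proof -
      have "int (L + 2) * int n \<le> int n * int n" using n0 by (intro mult_right_mono) auto
      then show ?thesis using N by (simp add: algebra_simps)
    qed
    have "q' \<in> admissible N"
    proof -
      have "q' l = -1" if "l \<le> -N" for l
        unfolding q'_def q_def
        by (rule trunc_far) (use m jk si LN that in \<open>auto simp: algebra_simps\<close>)
      moreover have "q' l = 1" if "l \<ge> N" for l
        unfolding q'_def q_def
        by (rule trunc_far) (use m jk si LN that in \<open>auto simp: algebra_simps\<close>)
      moreover have "\<bar>q' l\<bar> \<le> 1" for l unfolding q'_def q_def by (rule trunc_bound[OF m(4)])
      ultimately show ?thesis by (simp add: admissible_def)
    qed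
    then have "action b n p {-N..<N} \<le> action b n q' {-N..<N}" by (rule m(7))
    also have "\<dots> = action \<beta> n q {-N + s * int n..<N + s * int n}"
    proof -
      have "cell b n q' l = cell \<beta> n q (l + s * int n)" for l
        using m(1) by (simp add: cell_def q'_def \<beta>_def add_divide_distrib algebra_simps)
      then show ?thesis
        unfolding action_def
        by (intro sum.reindex_bij_witness[of _ "\<lambda>l. l - s * int n" "\<lambda>l. l + s * int n"]) auto
    qed
    also have "\<dots> \<le> action \<beta> n p {j..<k} + C * (1 + p j) + C * (1 - p k)"
      unfolding q_def using m jk si LN b_pos b_upper
      by (intro action_trunc) (auto simp: \<beta>_def less_imp_le algebra_simps)
    also have "\<dots> \<le> action \<beta> n p {j..<k} + C * \<theta> + C * \<theta>"
      using jk C_pos by (intro add_mono mult_left_mono) auto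
    finally have upper: "action b n p {-N..<N} \<le> action \<beta> n p {j..<k} + \<eta> / 4"
      using C\<theta> by linarith
    have "action b n p {j..<k} \<le> action b n p {-N..<N}"
      using b_pos by (intro action_le_admissible m) (auto simp: less_imp_le)
    with upper have "action b n p {j..<k} - action \<beta> n p {j..<k} \<le> \<eta> / 4" by linarith
    \<comment> \<open>The kinetic terms on \<open>{j..<k}\<close> are the same in both actions and
      cancel.\<close>
    then have le: "(\<Sum>l\<in>{j..<k}. (b (l / n) - \<beta> (l / n)) * V (p l) / n) \<le> \<eta> / 4"
      by (simp add: action_def cell_def sum_subtractf[symmetric] left_diff_distrib diff_divide_distrib)
    define W where "W = {i..i + \<lfloor>d * n\<rfloor>}"
    have nearW: "\<bar>p l\<bar> \<le> 1 - 1 / 4" if "l \<in> W" for l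
      using minimizer_near[OF min, of i "1 / 2" l] i that by (auto simp: W_def d_def)
    have "k \<notin> W" using nearW[of k] jk \<theta> by auto
    then have Wsub: "W \<subseteq> {j..<k}" using jk by (auto simp: W_def)
    have gapW: "g \<le> bP (l / n - s) - b (l / n - s)" if "l \<in> W" for l
    proof -
      have "\<lfloor>d * n\<rfloor> \<le> int n" using d mult_right_mono[of d 1 "real n"] by (simp add: floor_le_iff)
      then have "s * int n \<le> l" "l \<le> (s + 2) * int n"
        using that si by (auto simp: W_def algebra_simps)
      then have "real_of_int (s * int n) \<le> real_of_int l" "real_of_int l \<le> real_of_int ((s + 2) * int n)"
        by (simp_all only: of_int_le_iff)
      then have "0 \<le> l / n - s" "l / n - s \<le> 2"
        using m(1) by (auto simp: field_simps)
      then show ?thesis by (rule g(2))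
    qed
    have farjk: "\<bar>b (l / n) - bP (l / n)\<bar> < e" if "l \<in> {j..<k}" for l
    proof (rule R0)
      have "\<bar>i\<bar> \<le> \<bar>l\<bar> + int (L * n)" using that jk by auto
      then have "int (R1 * n) \<le> \<bar>l\<bar>" using far by (simp add: R_def algebra_simps)
      then have "real_of_int (int (R1 * n)) \<le> real_of_int \<bar>l\<bar>" by (simp only: of_int_le_iff)
      then have "real R1 \<le> \<bar>l / n\<bar>" using m(1) by (simp add: field_simps)
      then show "R0 \<le> \<bar>l / n\<bar>" using R1 by linarith
    qed
    have dn: "d * n \<le> card W" using d by (simp add: W_def)
    have "\<eta> = d * n * (g * \<mu> / n)" using m(1) by (simp add: \<eta>_def)
    also have "\<dots> \<le> card W * (g * \<mu> / n)"
      using dn g \<mu> by (intro mult_right_mono) auto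
    also have "\<dots> = (\<Sum>l\<in>W. g * \<mu> / n)" by simp
    also have "\<dots> \<le> (\<Sum>l\<in>W. (bP (l / n - s) - b (l / n - s)) * V (p l) / n)"
      using g(1) \<mu> V_nonneg gapW nearW
      by (intro sum_mono divide_right_mono mult_mono) (auto intro: less_imp_le[OF b_less])
    also have "\<dots> \<le> (\<Sum>l\<in>{j..<k}. (bP (l / n - s) - b (l / n - s)) * V (p l) / n)"
      using Wsub V_nonneg b_less by (intro sum_mono2) (auto simp: less_imp_le)
    \<comment> \<open>By periodicity \<open>bP\<close> takes the same value at the translated time,
      so \<open>bP - \<beta>\<close> splits into \<open>b - \<beta>\<close>, controlled by
      minimality, and \<open>bP - b\<close>, which is below \<open>e\<close> here.\<close>
    also have "\<dots> \<le> (\<Sum>l\<in>{j..<k}. (b (l / n) - \<beta> (l / n)) * V (p l) / n + e * (2 * D) / n)"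
    proof (rule sum_mono)
      fix l assume l: "l \<in> {j..<k}"
      have "V (p l) \<le> 2 * D"
        using V_le[OF m(4), of l] m(4)[of l] D_nonneg mult_left_mono[of "1 - p l" 2 D]
        by (auto simp: abs_le_iff)
      then have "e * V (p l) \<le> e * (2 * D)" using e by (intro mult_left_mono) auto
      moreover have "(bP (l / n) - b (l / n)) * V (p l) \<le> e * V (p l)"
        using farjk[OF l] V_nonneg by (intro mult_right_mono) auto
      ultimately have "(bP (l / n - s) - b (l / n - s)) * V (p l) \<le>
          (b (l / n) - \<beta> (l / n)) * V (p l) + e * (2 * D)"
        by (simp add: \<beta>_def bP_shift algebra_simps)
      then show "(bP (l / n - s) - b (l / n - s)) * V (p l) / n \<le>
          (b (l / n) - \<beta> (l / n)) * V (p l) / n + e * (2 * D) / n"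
        by (simp add: add_divide_distrib[symmetric] divide_right_mono)
    qed
    also have "\<dots> \<le> \<eta> / 4 + (\<Sum>l\<in>{j..<k}. e * (2 * D) / n)"
      using le by (simp add: sum.distrib)
    also have "(\<Sum>l\<in>{j..<k}. e * (2 * D) / n) \<le> \<eta> / 2"
    proof -
      have "(\<Sum>l\<in>{j..<k}. e * (2 * D) / n) = real_of_int (k - j) * (e * (2 * D) / n)"
        using jk by simp
      also have "\<dots> \<le> (2 * real L * n) * (e * (2 * D) / n)"
      proof (intro mult_right_mono)
        have "k - j \<le> int (2 * L * n)" using jk by simp
        then have "real_of_int (k - j) \<le> real_of_int (int (2 * L * n))" by (simp only: of_int_le_iff)
        then show "real_of_int (k - j) \<le> 2 * real L * n" by simp
      qed (use e D_nonneg in auto)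
      also have "\<dots> = 2 * real L * (e * (2 * D))" using m(1) by simp
      finally show ?thesis using eL by linarith
    qed
    finally show False using \<eta> by simp
  qed
  then show ?thesis by blast
qed

text \<open>Some point with a middle value exists and lies within \<open>R * n\<close> by
  \<open>transition_bounded\<close>. Around it, \<open>minimizer_window\<close> and
  \<open>minimizer_trapped\<close> confine all values at distance at least \<open>\<delta>\<close>
  from the wells. Beyond \<open>S * n\<close> the wrong well is excluded, since passing from it to
  the boundary value would require another crossing there.\<close>

lemma minimizer_localized:
  assumes "0 < \<delta>" "\<delta> \<le> 1 / 2"
  shows "\<exists>(S::nat) (n0::nat). \<forall>n N p i. n0 \<le> n \<longrightarrow> int n * int n \<le> N \<longrightarrow> minimizer n N p \<longrightarrow>
     (int (S * n) < i \<longrightarrow> 1 - \<delta> < p i) \<and> (i < - int (S * n) \<longrightarrow> p i < -1 + \<delta>)"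
proof -
  obtain R n0 :: nat where R: "\<And>n N p i. n0 \<le> n \<Longrightarrow> int n * int n \<le> N \<Longrightarrow> minimizer n N p \<Longrightarrow>
     \<bar>p i\<bar> \<le> 1 / 2 \<Longrightarrow> \<bar>i\<bar> \<le> int (R * n)"
    using transition_bounded by blast
  obtain \<theta> where \<theta>: "\<theta> > 0" and trap: "\<And>n N p i j k. minimizer n N p \<Longrightarrow> j \<le> k \<Longrightarrow>
      p j \<le> -1 + \<theta> \<Longrightarrow> 1 - \<theta> \<le> p k \<Longrightarrow> \<bar>p i\<bar> \<le> 1 - \<delta> \<Longrightarrow> j \<le> i \<and> i \<le> k"
    using minimizer_trapped[OF assms(1)] by blast
  obtain L :: nat where L: "\<And>n N p i. minimizer n N p \<Longrightarrow> \<bar>p i\<bar> \<le> 1 / 2 \<Longrightarrow>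
      \<exists>j k. i - int (L * n) \<le> j \<and> j \<le> i \<and> i \<le> k \<and> k \<le> i + int (L * n) \<and>
            p j \<le> -1 + \<theta> \<and> 1 - \<theta> \<le> p k"
    using minimizer_window[OF \<theta>] by blast
  define S where "S = R + L"
  have "(int (S * n) < i \<longrightarrow> 1 - \<delta> < p i) \<and> (i < - int (S * n) \<longrightarrow> p i < -1 + \<delta>)"
    if n: "max n0 (nat \<lceil>K\<rceil>) \<le> n" and N: "int n * int n \<le> N" and min: "minimizer n N p" for n N p i
  proof -
    note m = minimizerD[OF min]
    have K: "K \<le> n" using n by linarith
    obtain i0 where i0: "\<bar>p i0\<bar> \<le> 1 / 2"
      using minimizer_crosses[OF min _ K, of "1 / 2" "-N" N] m by auto
    obtain j k where jk: "i0 - int (L * n) \<le> j" "k \<le> i0 + int (L * n)" "j \<le> k"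
        "p j \<le> -1 + \<theta>" "1 - \<theta> \<le> p k"
      using L[OF min i0] by fastforce
    have inside: "\<bar>l\<bar> \<le> int (S * n)" if "\<bar>p l\<bar> \<le> 1 - \<delta>" for l
      using trap[OF min jk(3-5) that] R[OF _ N min i0] n jk by (auto simp: S_def algebra_simps)
    show ?thesis
    proof (intro conjI impI)
      assume i: "int (S * n) < i"
      show "1 - \<delta> < p i"
      proof (rule ccontr)
        assume "\<not> 1 - \<delta> < p i"
        then have "p i < - (1 - \<delta>)" using inside[of i] i by linarith
        moreover have "i \<le> max N i" "p (max N i) = 1" using m(6) by auto
        ultimately obtain l where "i \<le> l" "\<bar>p l\<bar> \<le> 1 - \<delta>"
          using minimizer_crosses[OF min _ K, of "1 - \<delta>" i "max N i"] assms by fastforce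
        then show False using inside[of l] i by simp
      qed
    next
      assume i: "i < - int (S * n)"
      show "p i < -1 + \<delta>"
      proof (rule ccontr)
        assume "\<not> p i < -1 + \<delta>"
        moreover have "min (-N) i \<le> i" "p (min (-N) i) = -1" using m(5) by auto
        ultimately obtain l where "l \<le> i" "\<bar>p l\<bar> \<le> 1 - \<delta>"
          using minimizer_crosses[OF min _ K, of "1 - \<delta>" "min (-N) i" i] assms by fastforce
        then show False using inside[of l] i by simp
      qed
    qed
  qed
  then show ?thesis by blast
qed

end

section \<open>Passage to the limit\<close>

lemma floor_div_bound:
  assumes "m > 0"
  shows "\<bar>of_int \<lfloor>t * real m\<rfloor> / real m - t\<bar> \<le> 1 / real m"
proof -
  have "of_int \<lfloor>t * real m\<rfloor> / real m - t = (of_int \<lfloor>t * real m\<rfloor> - t * real m) / real m"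
    using assms by (simp add: diff_divide_distrib)
  moreover have "\<bar>of_int \<lfloor>t * real m\<rfloor> - t * real m\<bar> \<le> 1" by linarith
  ultimately show ?thesis by (simp add: divide_right_mono)
qed

lemma floor_div_tendsto:
  assumes "filterlim r at_top sequentially"
  shows "(\<lambda>n. of_int \<lfloor>t * real (r n)\<rfloor> / real (r n)) \<longlonglongrightarrow> t"
proof -
  have r: "filterlim (\<lambda>n. real (r n)) at_top sequentially"
    by (rule filterlim_compose[OF filterlim_real_sequentially assms])
  have "(\<lambda>n. of_int \<lfloor>t * real (r n)\<rfloor> / real (r n) - t) \<longlonglongrightarrow> 0"
  proof (rule Lim_null_comparison)
    show "(\<lambda>n. 1 / real (r n)) \<longlonglongrightarrow> 0"
      using tendsto_inverse_0_at_top[OF r] by (simp add: divide_inverse)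
    show "\<forall>\<^sub>F n in sequentially. norm (of_int \<lfloor>t * real (r n)\<rfloor> / real (r n) - t) \<le> 1 / real (r n)"
      using filterlim_at_top_dense[THEN iffD1, OF r, rule_format, of 0]
    proof eventually_elim
      case (elim n)
      then show ?case using floor_div_bound[of "r n" t] by simp
    qed
  qed
  then show ?thesis using LIM_zero_iff by blast
qed

lemma int_increment_bound:
  fixes f :: "int \<Rightarrow> real"
  assumes "i \<le> j" "\<And>k. i \<le> k \<Longrightarrow> k < j \<Longrightarrow> \<bar>f (k + 1) - f k\<bar> \<le> c"
  shows "\<bar>f j - f i\<bar> \<le> c * real_of_int (j - i)"
proof -
  have "f j - f i = (\<Sum>k\<in>{i..<j}. f (k + 1) - f k)" by (rule sum_int_telescope[symmetric, OF assms(1)])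
  also have "\<bar>\<dots>\<bar> \<le> (\<Sum>k\<in>{i..<j}. c)" by (rule order_trans[OF sum_abs sum_mono]) (use assms in auto)
  also have "\<dots> = c * real_of_int (j - i)" using assms(1) by simp
  finally show ?thesis .
qed

text \<open>Subtracting a line of slope \<open>g\<close> leaves increments of at most
  \<open>e\<close> per unit of time near \<open>s\<close>. This survives pointwise convergence and
  yields the difference quotient estimate for \<open>U\<close>. It serves for positions and for
  velocities.\<close>

lemma step_function_limit_derivative:
  fixes u :: "nat \<Rightarrow> int \<Rightarrow> real" and r :: "nat \<Rightarrow> nat"
  assumes r: "filterlim r at_top sequentially"
    and U: "\<And>t. (\<lambda>n. u n \<lfloor>t * real (r n)\<rfloor>) \<longlonglongrightarrow> U t"
    and slope: "\<And>e. e > 0 \<Longrightarrow> \<exists>d>0. \<forall>\<^sub>F n in sequentially. \<forall>i. \<bar>of_int i / real (r n) - s\<bar> \<le> d \<longrightarrow>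
                   \<bar>real (r n) * (u n (i + 1) - u n i) - g\<bar> \<le> e"
  shows "(U has_real_derivative g) (at s)"
  unfolding has_field_derivative_iff
proof (rule LIM_I)
  fix e :: real assume "e > 0"
  then obtain d where d: "d > 0" and ev: "\<forall>\<^sub>F n in sequentially. \<forall>i. \<bar>of_int i / real (r n) - s\<bar> \<le> d \<longrightarrow>
                   \<bar>real (r n) * (u n (i + 1) - u n i) - g\<bar> \<le> e / 2"
    using slope[of "e / 2"] by auto
  have rpos: "\<forall>\<^sub>F n in sequentially. 0 < r n"
    using filterlim_at_top[THEN iffD1, OF r, rule_format, of 1] by (simp add: Suc_le_eq)
  define q where "q t n = of_int \<lfloor>t * real (r n)\<rfloor> / real (r n)" for t n
  have q: "(\<lambda>n. q t n) \<longlonglongrightarrow> t" for t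
    unfolding q_def by (rule floor_div_tendsto[OF r])
  have close: "\<forall>\<^sub>F n in sequentially. \<bar>q t n - s\<bar> < d" if "\<bar>t - s\<bar> < d" for t
  proof -
    have "(\<lambda>n. \<bar>q t n - s\<bar>) \<longlonglongrightarrow> \<bar>t - s\<bar>" by (intro tendsto_intros q)
    then show ?thesis using that by (rule order_tendstoD(2))
  qed
  have main: "\<bar>U t - U s - g * (t - s)\<bar> \<le> e / 2 * \<bar>t - s\<bar>" if t: "\<bar>t - s\<bar> < d" for t
  proof (rule tendsto_le[OF sequentially_bot])
    show "(\<lambda>n. \<bar>u n \<lfloor>t * real (r n)\<rfloor> - u n \<lfloor>s * real (r n)\<rfloor> - g * (q t n - q s n)\<bar>) \<longlonglongrightarrow>
        \<bar>U t - U s - g * (t - s)\<bar>"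
      by (intro tendsto_intros U q)
    show "(\<lambda>n. e / 2 * \<bar>q t n - q s n\<bar>) \<longlonglongrightarrow> e / 2 * \<bar>t - s\<bar>"
      by (intro tendsto_intros q)
    have "\<forall>\<^sub>F n in sequentially. \<bar>q s n - s\<bar> < d" by (rule close) (use d in simp)
    with ev rpos close[OF t]
    show "\<forall>\<^sub>F n in sequentially. \<bar>u n \<lfloor>t * real (r n)\<rfloor> - u n \<lfloor>s * real (r n)\<rfloor> - g * (q t n - q s n)\<bar>
        \<le> e / 2 * \<bar>q t n - q s n\<bar>"
    proof eventually_elim
      case (elim n)
      define i j where "i = \<lfloor>s * real (r n)\<rfloor>" and "j = \<lfloor>t * real (r n)\<rfloor>"
      define f where "f k = u n k - g * (of_int k / real (r n))" for k
      have ij: "\<bar>of_int i / real (r n) - s\<bar> < d" "\<bar>of_int j / real (r n) - s\<bar> < d"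
        using elim by (auto simp: q_def i_def j_def)
      have step: "\<bar>f (k + 1) - f k\<bar> \<le> e / 2 / real (r n)" if "min i j \<le> k" "k < max i j" for k
      proof -
        have "real_of_int (min i j) / real (r n) \<le> of_int k / real (r n)"
          "of_int k / real (r n) \<le> real_of_int (max i j) / real (r n)"
          using that by (intro divide_right_mono; simp)+
        then have "\<bar>of_int k / real (r n) - s\<bar> \<le> d" using ij by (auto simp: min_def max_def split: if_splits)
        then have "\<bar>real (r n) * (u n (k + 1) - u n k) - g\<bar> \<le> e / 2" using elim by blast
        moreover have "f (k + 1) - f k = (real (r n) * (u n (k + 1) - u n k) - g) / real (r n)"
          using elim by (simp add: f_def field_simps)
        ultimately show ?thesis by (simp only: abs_divide abs_of_nat divide_right_mono of_nat_0_le_iff)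
      qed
      have "\<bar>f j - f i\<bar> \<le> e / 2 / real (r n) * \<bar>real_of_int (j - i)\<bar>"
      proof (cases "i \<le> j")
        case True
        then show ?thesis using int_increment_bound[of i j f "e / 2 / real (r n)"] step by auto
      next
        case False
        then have "\<bar>f i - f j\<bar> \<le> e / 2 / real (r n) * real_of_int (i - j)"
          by (intro int_increment_bound step) auto
        then show ?thesis using False by (simp add: abs_minus_commute)
      qed
      also have "\<dots> = e / 2 * \<bar>q t n - q s n\<bar>"
        by (simp add: q_def i_def j_def diff_divide_distrib[symmetric])
      finally show ?case
        by (simp add: f_def q_def i_def j_def algebra_simps)
    qed
  qed
  have "norm ((U (s + h) - U s) / h - g) < e" if "h \<noteq> 0" "norm (h - 0) < d" for h
  proof -
    have "(U (s + h) - U s) / h - g = (U (s + h) - U s - g * (s + h - s)) / h"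
      using that by (simp add: field_simps)
    then have "norm ((U (s + h) - U s) / h - g) \<le> e / 2"
      using main[of "s + h"] that by (simp add: divide_le_eq)
    then show ?thesis using \<open>e > 0\<close> by simp
  qed
  then show "\<exists>d>0. \<forall>y. y \<noteq> s \<and> norm (y - s) < d \<longrightarrow> norm ((U y - U s) / (y - s) - g) < e"
    using d by (intro exI[of _ d]) (metis add.commute diff_add_cancel diff_zero right_minus_eq)
qed

lemma exists_small_multiple:
  fixes c e :: real
  assumes "c \<ge> 0" "e > 0"
  shows "\<exists>d>0. c * d \<le> e"
  using assms by (intro exI[of _ "e / (c + 1)"]) (auto simp: divide_le_eq algebra_simps)

text \<open>Comparison with a nearby rational gives the Cauchy property. The term \<open>h n\<close>
  absorbs the rounding to the grid, and the estimate is asked only eventually because velocities are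
  controlled only inside a window that grows with \<open>n\<close>.\<close>

lemma convergent_of_dense_Lipschitz:
  fixes F :: "nat \<Rightarrow> real \<Rightarrow> real"
  assumes conv: "\<And>q. q \<in> \<rat> \<Longrightarrow> convergent (\<lambda>n. F n q)"
    and lip: "\<And>s t. \<forall>\<^sub>F n in sequentially. \<bar>F n s - F n t\<bar> \<le> c * (\<bar>s - t\<bar> + h n)"
    and h: "h \<longlonglongrightarrow> 0" and c: "c \<ge> 0"
  shows "convergent (\<lambda>n. F n t)"
proof -
  have "Cauchy (\<lambda>n. F n t)"
  proof (rule metric_CauchyI)
    fix e :: real assume e: "e > 0"
    obtain d where d: "d > 0" and "2 * c * d \<le> e / 4"
      using exists_small_multiple[of "2 * c" "e / 4"] e c by auto
    then have cd: "c * (d + d) \<le> e / 4" by (simp add: algebra_simps)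
    obtain q where q: "q \<in> \<rat>" "t < q" "q < t + d" using Rats_dense_in_real[of t "t + d"] d by auto
    have "Cauchy (\<lambda>n. F n q)" using conv[OF q(1)] by (simp add: Cauchy_convergent_iff)
    then obtain M where M: "\<And>m n. m \<ge> M \<Longrightarrow> n \<ge> M \<Longrightarrow> dist (F m q) (F n q) < e / 4"
      using metric_CauchyD[of "\<lambda>n. F n q" "e / 4"] e by auto
    have "\<forall>\<^sub>F n in sequentially. h n < d" using h d by (rule order_tendstoD(2))
    with lip[of t q] have "\<forall>\<^sub>F n in sequentially. \<bar>F n t - F n q\<bar> \<le> e / 4"
    proof eventually_elim
      case (elim n)
      have "c * (\<bar>t - q\<bar> + h n) \<le> c * (d + d)" using q elim c by (intro mult_left_mono) auto
      then show ?case using elim cd by linarith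
    qed
    then obtain M' where M': "\<And>n. n \<ge> M' \<Longrightarrow> \<bar>F n t - F n q\<bar> \<le> e / 4"
      by (auto simp: eventually_sequentially)
    show "\<exists>M. \<forall>m\<ge>M. \<forall>n\<ge>M. dist (F m t) (F n t) < e"
    proof (intro exI allI impI)
      fix m n assume "m \<ge> max M M'" "n \<ge> max M M'"
      then show "dist (F m t) (F n t) < e"
        using M[of m n] M'[of m] M'[of n] e unfolding dist_real_def by linarith
    qed
  qed
  then show ?thesis by (simp add: Cauchy_convergent_iff)
qed

text \<open>Gronwall's argument for the energy \<open>(x - z)\<^sup>2 + v\<^sup>2\<close>.\<close>

lemma equilibrium_unique:
  fixes x v w :: "real \<Rightarrow> real"
  assumes x: "\<And>t. (x has_real_derivative v t) (at t)"
    and v: "\<And>t. (v has_real_derivative w t) (at t)"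
    and w: "\<And>t. \<bar>w t\<bar> \<le> M * \<bar>x t - z\<bar>" and "M \<ge> 0"
    and init: "x s = z" "v s = 0"
  shows "x t = z"
proof -
  define E where "E t = (x t - z)\<^sup>2 + (v t)\<^sup>2" for t
  define E' where "E' t = 2 * ((x t - z) * v t) + 2 * (v t * w t)" for t
  have E: "(E has_real_derivative E' t) (at t)" for t
    unfolding E_def E'_def by (auto intro!: derivative_eq_intros x v simp: algebra_simps)
  have bound: "\<bar>E' t\<bar> \<le> (1 + M) * E t" for t
  proof -
    have "2 * (\<bar>x t - z\<bar> * \<bar>v t\<bar>) \<le> E t"
      using zero_le_power2[of "\<bar>x t - z\<bar> - \<bar>v t\<bar>"] by (simp add: E_def power2_diff)
    moreover have "\<bar>v t\<bar> * \<bar>w t\<bar> \<le> \<bar>v t\<bar> * (M * \<bar>x t - z\<bar>)" using w by (intro mult_left_mono) auto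
    moreover have "\<bar>E' t\<bar> \<le> 2 * (\<bar>x t - z\<bar> * \<bar>v t\<bar>) + 2 * (\<bar>v t\<bar> * \<bar>w t\<bar>)"
      unfolding E'_def by (rule order_trans[OF abs_triangle_ineq]) (simp add: abs_mult)
    ultimately have "\<bar>E' t\<bar> \<le> (1 + M) * (2 * (\<bar>x t - z\<bar> * \<bar>v t\<bar>))" by (simp add: algebra_simps)
    also have "\<dots> \<le> (1 + M) * E t"
      using \<open>2 * (\<bar>x t - z\<bar> * \<bar>v t\<bar>) \<le> E t\<close> \<open>M \<ge> 0\<close> by (intro mult_left_mono) auto
    finally show ?thesis .
  qed
  have E0: "E s = 0" using init by (simp add: E_def)
  \<comment> \<open>To the right of \<open>s\<close> the energy is weighted with a decaying
    exponential, to the left with a growing one; in both cases the bound on \<open>E'\<close> makes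
    the product monotone and compares it with its value \<open>0\<close> at
    \<open>s\<close>.\<close>
  have "E t \<le> 0"
  proof (cases "s \<le> t")
    case True
    have "E t * exp (- (1 + M) * t) \<le> E s * exp (- (1 + M) * s)"
    proof (rule DERIV_nonpos_imp_nonincreasing[OF True])
      fix y
      have "((\<lambda>t. E t * exp (- (1 + M) * t)) has_real_derivative
          (E' y - (1 + M) * E y) * exp (- (1 + M) * y)) (at y)"
        by (auto intro!: derivative_eq_intros E simp: algebra_simps)
      moreover have "(E' y - (1 + M) * E y) * exp (- (1 + M) * y) \<le> 0"
        using bound[of y] by (intro mult_nonpos_nonneg) auto
      ultimately show "\<exists>D. ((\<lambda>t. E t * exp (- (1 + M) * t)) has_real_derivative D) (at y) \<and> D \<le> 0"
        by blast
    qed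
    then show ?thesis using E0 by (simp add: mult_le_0_iff)
  next
    case False
    have "E t * exp ((1 + M) * t) \<le> E s * exp ((1 + M) * s)"
    proof (rule DERIV_nonneg_imp_nondecreasing[of t s])
      fix y
      have "((\<lambda>t. E t * exp ((1 + M) * t)) has_real_derivative
          (E' y + (1 + M) * E y) * exp ((1 + M) * y)) (at y)"
        by (auto intro!: derivative_eq_intros E simp: algebra_simps)
      moreover have "(E' y + (1 + M) * E y) * exp ((1 + M) * y) \<ge> 0"
        using bound[of y] by (intro mult_nonneg_nonneg) auto
      ultimately show "\<exists>D. ((\<lambda>t. E t * exp ((1 + M) * t)) has_real_derivative D) (at y) \<and> D \<ge> 0"
        by blast
    qed (use False in simp)
    then show ?thesis using E0 by (simp add: mult_le_0_iff)
  qed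
  then show ?thesis by (simp add: E_def sum_power2_le_zero_iff)
qed

context double_well
begin

text \<open>Summation of the second difference bound, which holds only at interior indices; hence
  the margin of one index at the boundary.\<close>

lemma minimizer_velocity_Lipschitz:
  assumes min: "minimizer n N p" and ij: "\<bar>i\<bar> + 1 < N" "\<bar>j\<bar> + 1 < N"
  shows "\<bar>n * (p (j + 1) - p j) - n * (p (i + 1) - p i)\<bar> \<le> B * D * \<bar>real_of_int (j - i)\<bar> / n"
proof -
  have n: "n \<ge> 1" by (rule minimizerD[OF min])
  define f where "f k = n * (p (k + 1) - p k)" for k
  have step: "\<bar>f (k + 1) - f k\<bar> \<le> B * D / n" if "min i j \<le> k" "k < max i j" for k
  proof -
    have "\<bar>k + 1\<bar> < N" using that ij by auto
    then have "\<bar>p (k + 2) - 2 * p (k + 1) + p k\<bar> \<le> B * D / (real n)\<^sup>2"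
      using minimizer_second_difference[OF min, of "k + 1"] by (simp add: add.assoc)
    then have "n * \<bar>p (k + 2) - 2 * p (k + 1) + p k\<bar> \<le> n * (B * D / (real n)\<^sup>2)"
      by (intro mult_left_mono) auto
    moreover have "f (k + 1) - f k = n * (p (k + 2) - 2 * p (k + 1) + p k)"
      by (simp add: f_def algebra_simps)
    ultimately show ?thesis using n by (simp add: abs_mult power2_eq_square)
  qed
  have "\<bar>f j - f i\<bar> \<le> B * D / n * \<bar>real_of_int (j - i)\<bar>"
  proof (cases "i \<le> j")
    case True
    then show ?thesis using int_increment_bound[of i j f "B * D / n"] step by auto
  next
    case False
    then have "\<bar>f i - f j\<bar> \<le> B * D / n * real_of_int (i - j)"
      by (intro int_increment_bound step) auto
    then show ?thesis using False by (simp add: abs_minus_commute)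
  qed
  then show ?thesis by (simp add: f_def)
qed

text \<open>An Arzela-Ascoli argument for positions and velocities together. With
  \<open>N = n * n\<close> the window covers times up to \<open>n\<close>, so every fixed time is
  eventually interior and the difference equation passes to the limit.\<close>

lemma minimizers_limit:
  assumes b_cont: "continuous_on UNIV b" and V'_cont: "continuous_on UNIV V'"
    and P: "\<And>n. n \<ge> 1 \<Longrightarrow> minimizer n (int n * int n) (P n)"
  obtains r x v where "strict_mono r" "\<And>n. r n \<ge> 1"
    "\<And>t. (\<lambda>n. P (r n) \<lfloor>t * real (r n)\<rfloor>) \<longlonglongrightarrow> x t"
    "\<And>t. (x has_real_derivative v t) (at t)"
    "\<And>t. (v has_real_derivative b t * V' (x t)) (at t)"
proof -
  define vel where "vel n i = real n * (P n (i + 1) - P n i)" for n i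
  have vel_bound: "\<bar>vel n i\<bar> \<le> K" if "n \<ge> 1" for n i
    using minimizer_step[OF P[OF that], of i] that
      mult_left_mono[of "\<bar>P n (i + 1) - P n i\<bar>" "K / n" "real n"] by (simp add: vel_def abs_mult)
  \<comment> \<open>Pairing position and velocity lets one diagonal extraction over the rationals
    serve both; \<open>Suc n\<close> avoids mesh parameter \<open>0\<close>.\<close>
  define F where "F n t = (P (Suc n) \<lfloor>t * real (Suc n)\<rfloor>, vel (Suc n) \<lfloor>t * real (Suc n)\<rfloor>)" for n t
  have "norm (F n t) \<le> 1 + K" for n t
  proof -
    have "norm (F n t) \<le> \<bar>P (Suc n) \<lfloor>t * real (Suc n)\<rfloor>\<bar> + \<bar>vel (Suc n) \<lfloor>t * real (Suc n)\<rfloor>\<bar>"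
      unfolding F_def real_norm_def[symmetric] by (rule norm_Pair_le)
    also have "\<dots> \<le> 1 + K" by (intro add_mono minimizerD(4)[OF P] vel_bound) auto
    finally show ?thesis .
  qed
  then obtain k where k: "strict_mono (k :: nat \<Rightarrow> nat)"
      and F: "\<And>q. q \<in> \<rat> \<Longrightarrow> \<exists>l. (\<lambda>n. F (k n) q) \<longlonglongrightarrow> l"
    using function_convergent_subsequence[OF countable_rat, of F "1 + K"] by blast
  define r where "r n = Suc (k n)" for n
  have r: "strict_mono r" "\<And>n. r n \<ge> 1" using k by (auto simp: r_def strict_mono_def)
  have r_top: "filterlim r at_top sequentially" by (rule filterlim_subseq[OF r(1)])
  have large: "\<forall>\<^sub>F n in sequentially. c \<le> real (r n)" for c
    using filterlim_compose[OF filterlim_real_sequentially r_top] by (simp add: filterlim_at_top)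
  have inv: "(\<lambda>n. 1 / real (r n)) \<longlonglongrightarrow> 0"
    using tendsto_inverse_0_at_top[OF filterlim_compose[OF filterlim_real_sequentially r_top]]
    by (simp add: divide_inverse)
  have fl: "\<bar>of_int i - of_int \<lfloor>t * real m\<rfloor>\<bar> / real m \<le> \<bar>of_int i / real m - t\<bar> + 1 / real m"
    if "m \<ge> 1" for i m t
  proof -
    have "\<bar>of_int i - of_int \<lfloor>t * real m\<rfloor>\<bar> \<le> \<bar>of_int i - t * real m\<bar> + 1" by linarith
    then have "\<bar>of_int i - of_int \<lfloor>t * real m\<rfloor>\<bar> / real m \<le> (\<bar>of_int i - t * real m\<bar> + 1) / real m"
      by (intro divide_right_mono) auto
    also have "of_int i - t * real m = (of_int i / real m - t) * real m"
      using that by (simp add: left_diff_distrib)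
    finally show ?thesis using that by (simp add: abs_mult add_divide_distrib)
  qed
  have small: "\<bar>i\<bar> + 1 < int m * int m" if "\<bar>of_int i / real m - t\<bar> \<le> d" "\<bar>t\<bar> + d + 2 \<le> real m" for i m t d
  proof -
    have m: "real m > 0" using that by linarith
    have "\<bar>of_int i / real m\<bar> + 2 \<le> real m" using that by linarith
    then have "(\<bar>of_int i / real m\<bar> + 2) * real m \<le> real m * real m" using m by (intro mult_right_mono) auto
    moreover have "\<bar>of_int i / real m\<bar> * real m = \<bar>real_of_int i\<bar>" using m by simp
    moreover have "real m \<ge> 1" using m by simp
    ultimately have "\<bar>real_of_int i\<bar> + 1 < real m * real m" by (simp add: algebra_simps)
    then have "real_of_int (\<bar>i\<bar> + 1) < real_of_int (int m * int m)" by simp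
    then show ?thesis by (simp only: of_int_less_iff)
  qed
  have fl0: "\<bar>of_int \<lfloor>t * real m\<rfloor> / real m - t\<bar> \<le> 1 / real m" if "m \<ge> 1" for m t
    using that by (intro floor_div_bound) simp
  have inv_le: "1 / real m \<le> 1" if "m \<ge> 1" for m using that by simp
  have xlip: "\<bar>P (r n) i - P (r n) \<lfloor>t * real (r n)\<rfloor>\<bar> \<le> K * (\<bar>of_int i / real (r n) - t\<bar> + 1 / real (r n))"
    for n i t
  proof -
    have "\<bar>P (r n) i - P (r n) \<lfloor>t * real (r n)\<rfloor>\<bar> \<le> K * (\<bar>of_int i - of_int \<lfloor>t * real (r n)\<rfloor>\<bar> / real (r n))"
      using minimizer_Lipschitz[OF P[OF r(2)[of n]], of i "\<lfloor>t * real (r n)\<rfloor>"] by simp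
    also have "\<dots> \<le> K * (\<bar>of_int i / real (r n) - t\<bar> + 1 / real (r n))"
      using K_ge by (intro mult_left_mono fl r) auto
    finally show ?thesis .
  qed
  have BD: "B * D \<ge> 0" using B_pos D_nonneg by simp
  have vlip: "\<bar>vel (r n) i - vel (r n) \<lfloor>t * real (r n)\<rfloor>\<bar> \<le> B * D * (\<bar>of_int i / real (r n) - t\<bar> + 1 / real (r n))"
    if "\<bar>of_int i / real (r n) - t\<bar> \<le> d" "\<bar>t\<bar> + d + 3 \<le> real (r n)" for n i t d
  proof -
    have d: "0 \<le> d" using that by linarith
    have "\<bar>vel (r n) i - vel (r n) \<lfloor>t * real (r n)\<rfloor>\<bar> \<le> B * D * (\<bar>of_int i - of_int \<lfloor>t * real (r n)\<rfloor>\<bar> / real (r n))"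
      using minimizer_velocity_Lipschitz[OF P[OF r(2)[of n]], of "\<lfloor>t * real (r n)\<rfloor>" i]
        small[of i "r n" t d] small[of "\<lfloor>t * real (r n)\<rfloor>" "r n" t 1] that d
        fl0[OF r(2), of t n] inv_le[OF r(2), of n]
      by (simp add: vel_def)
    also have "\<dots> \<le> B * D * (\<bar>of_int i / real (r n) - t\<bar> + 1 / real (r n))"
      using BD by (intro mult_left_mono fl r) auto
    finally show ?thesis .
  qed
  have Frat: "convergent (\<lambda>n. P (r n) \<lfloor>q * real (r n)\<rfloor>)" "convergent (\<lambda>n. vel (r n) \<lfloor>q * real (r n)\<rfloor>)"
    if "q \<in> \<rat>" for q
  proof -
    obtain l where l: "(\<lambda>n. F (k n) q) \<longlonglongrightarrow> l" using F[OF \<open>q \<in> \<rat>\<close>] by blast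
    show "convergent (\<lambda>n. P (r n) \<lfloor>q * real (r n)\<rfloor>)"
      using tendsto_fst[OF l] by (auto simp: convergent_def F_def r_def)
    show "convergent (\<lambda>n. vel (r n) \<lfloor>q * real (r n)\<rfloor>)"
      using tendsto_snd[OF l] by (auto simp: convergent_def F_def r_def)
  qed
  have h2: "(\<lambda>n. 2 * (1 / real (r n))) \<longlonglongrightarrow> 0" using tendsto_mult_left[OF inv, of 2] by simp
  have near: "\<bar>of_int \<lfloor>s * real (r n)\<rfloor> / real (r n) - t\<bar> \<le> \<bar>s - t\<bar> + 1 / real (r n)" for s t n
    using fl0[OF r(2), of s n] by linarith
  have "convergent (\<lambda>n. P (r n) \<lfloor>t * real (r n)\<rfloor>)" for t
  proof (rule convergent_of_dense_Lipschitz[OF Frat(1) _ h2])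
    show "\<forall>\<^sub>F n in sequentially. \<bar>P (r n) \<lfloor>s * real (r n)\<rfloor> - P (r n) \<lfloor>t * real (r n)\<rfloor>\<bar> \<le>
        K * (\<bar>s - t\<bar> + 2 * (1 / real (r n)))" for s t
    proof (intro always_eventually allI)
      fix n
      show "\<bar>P (r n) \<lfloor>s * real (r n)\<rfloor> - P (r n) \<lfloor>t * real (r n)\<rfloor>\<bar> \<le> K * (\<bar>s - t\<bar> + 2 * (1 / real (r n)))"
        by (rule order_trans[OF xlip mult_left_mono]) (use near[of s n t] K_ge in auto)
    qed
  qed (use K_ge in auto)
  then obtain x where x: "\<And>t. (\<lambda>n. P (r n) \<lfloor>t * real (r n)\<rfloor>) \<longlonglongrightarrow> x t"
    unfolding convergent_def by metis
  have "convergent (\<lambda>n. vel (r n) \<lfloor>t * real (r n)\<rfloor>)" for t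
  proof (rule convergent_of_dense_Lipschitz[OF Frat(2) _ h2 BD])
    show "\<forall>\<^sub>F n in sequentially. \<bar>vel (r n) \<lfloor>s * real (r n)\<rfloor> - vel (r n) \<lfloor>t * real (r n)\<rfloor>\<bar> \<le>
        B * D * (\<bar>s - t\<bar> + 2 * (1 / real (r n)))" for s t
      using large[of "\<bar>t\<bar> + (\<bar>s - t\<bar> + 1) + 3"]
    proof eventually_elim
      case (elim n)
      have "\<bar>of_int \<lfloor>s * real (r n)\<rfloor> / real (r n) - t\<bar> \<le> \<bar>s - t\<bar> + 1"
        using near[of s n t] inv_le[OF r(2), of n] by linarith
      then show ?case
        by (rule order_trans[OF vlip[OF _ elim] mult_left_mono]) (use near[of s n t] BD in auto)
    qed
  qed auto
  then obtain v where v: "\<And>t. (\<lambda>n. vel (r n) \<lfloor>t * real (r n)\<rfloor>) \<longlonglongrightarrow> v t"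
    unfolding convergent_def by metis
  have "(x has_real_derivative v s) (at s)" for s
  proof (rule step_function_limit_derivative[where u = "\<lambda>n. P (r n)", OF r_top x])
    fix e :: real assume e: "e > 0"
    obtain d where d: "d > 0" and "2 * (B * D) * d \<le> e / 2"
      using exists_small_multiple[of "2 * (B * D)" "e / 2"] e BD by auto
    then have BDd: "B * D * (d + d) \<le> e / 2" by (simp add: algebra_simps)
    have "\<forall>\<^sub>F n in sequentially. \<bar>vel (r n) \<lfloor>s * real (r n)\<rfloor> - v s\<bar> < e / 2"
      using tendstoD[OF v, of "e / 2"] e by (simp add: dist_real_def)
    moreover have "\<forall>\<^sub>F n in sequentially. 1 / real (r n) < d" using inv d by (rule order_tendstoD(2))
    ultimately have "\<forall>\<^sub>F n in sequentially. \<forall>i. \<bar>of_int i / real (r n) - s\<bar> \<le> d \<longrightarrow>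
        \<bar>real (r n) * (P (r n) (i + 1) - P (r n) i) - v s\<bar> \<le> e"
      using large[of "\<bar>s\<bar> + d + 3"]
    proof eventually_elim
      case (elim n)
      show ?case
      proof (intro allI impI)
        fix i assume i: "\<bar>of_int i / real (r n) - s\<bar> \<le> d"
        have "B * D * (\<bar>of_int i / real (r n) - s\<bar> + 1 / real (r n)) \<le> B * D * (d + d)"
          using i elim BD by (intro mult_left_mono) auto
        then have "\<bar>vel (r n) i - v s\<bar> \<le> e" using vlip[OF i] elim BDd by linarith
        then show "\<bar>real (r n) * (P (r n) (i + 1) - P (r n) i) - v s\<bar> \<le> e" by (simp add: vel_def)
      qed
    qed
    then show "\<exists>d>0. \<forall>\<^sub>F n in sequentially. \<forall>i. \<bar>of_int i / real (r n) - s\<bar> \<le> d \<longrightarrow>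
        \<bar>real (r n) * (P (r n) (i + 1) - P (r n) i) - v s\<bar> \<le> e" using d by blast
  qed
  moreover have "(v has_real_derivative b s * V' (x s)) (at s)" for s
  proof (rule step_function_limit_derivative[where u = "\<lambda>n. vel (r n)", OF r_top v])
    fix e :: real assume e: "e > 0"
    have "((\<lambda>z. b (fst z) * V' (snd z)) \<longlongrightarrow> b (fst (s, x s)) * V' (snd (s, x s))) (nhds (s, x s))"
      using b_cont V'_cont
      by (intro tendsto_mult; intro isCont_tendsto_compose[of _ b] isCont_tendsto_compose[of _ V'] tendsto_fst tendsto_snd filterlim_ident)
         (auto simp: continuous_on_eq_continuous_at)
    then have "\<forall>\<^sub>F z in nhds (s, x s). \<bar>b (fst z) * V' (snd z) - b s * V' (x s)\<bar> < e"
      using tendstoD[OF _ e] by (fastforce simp: dist_real_def)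
    then obtain d0 where d0: "d0 > 0"
        and near0: "\<And>z. dist z (s, x s) < d0 \<Longrightarrow> \<bar>b (fst z) * V' (snd z) - b s * V' (x s)\<bar> < e"
      unfolding eventually_nhds_metric by blast
    \<comment> \<open>Below, the time differs from \<open>s\<close> by at most \<open>2 * d\<close>
      and the position from \<open>x s\<close> by less than \<open>3 * (K * d) + d0 / 4\<close>;
      this choice of \<open>d\<close> keeps the sum below \<open>d0\<close>.\<close>
    obtain d where d: "d > 0" and Kd: "(4 * K + 4) * d \<le> d0 / 2"
      using exists_small_multiple[of "4 * K + 4" "d0 / 2"] d0 K_ge by auto
    have Kd': "K * d \<ge> 0" using d K_ge by simp
    have "\<forall>\<^sub>F n in sequentially. \<bar>P (r n) \<lfloor>s * real (r n)\<rfloor> - x s\<bar> < d0 / 4"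
      using tendstoD[OF x, of "d0 / 4"] d0 by (simp add: dist_real_def)
    moreover have "\<forall>\<^sub>F n in sequentially. 1 / real (r n) < d" using inv d by (rule order_tendstoD(2))
    ultimately have "\<forall>\<^sub>F n in sequentially. \<forall>i. \<bar>of_int i / real (r n) - s\<bar> \<le> d \<longrightarrow>
        \<bar>real (r n) * (vel (r n) (i + 1) - vel (r n) i) - b s * V' (x s)\<bar> \<le> e"
      using large[of "\<bar>s\<bar> + 2 * d + 2"]
    proof eventually_elim
      case (elim n)
      show ?case
      proof (intro allI impI)
        fix i assume i: "\<bar>of_int i / real (r n) - s\<bar> \<le> d"
        \<comment> \<open>The forward difference of velocities at \<open>i\<close> is the second
          difference of positions centred at \<open>i + 1\<close>, so the equation is evaluated
          there.\<close>
        define \<tau> where "\<tau> = of_int (i + 1) / real (r n)"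
        define y where "y = P (r n) (i + 1)"
        have "\<tau> = of_int i / real (r n) + 1 / real (r n)" by (simp add: \<tau>_def add_divide_distrib)
        moreover have "0 \<le> 1 / real (r n)" by simp
        ultimately have \<tau>: "\<bar>\<tau> - s\<bar> \<le> 2 * d" using i elim by linarith
        have "\<bar>y - P (r n) \<lfloor>s * real (r n)\<rfloor>\<bar> \<le> K * (\<bar>\<tau> - s\<bar> + 1 / real (r n))"
          unfolding y_def \<tau>_def by (rule xlip)
        also have "\<dots> \<le> K * (3 * d)" using \<tau> elim K_ge by (intro mult_left_mono) auto
        also have "\<dots> = 3 * (K * d)" by simp
        finally have y: "\<bar>y - x s\<bar> < 3 * (K * d) + d0 / 4" using elim by linarith
        have "dist (\<tau>, y) (s, x s) \<le> \<bar>\<tau> - s\<bar> + \<bar>y - x s\<bar>"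
          unfolding dist_norm by (simp add: norm_Pair_le[of "\<tau> - s" "y - x s", simplified])
        also have "\<dots> < d0" using \<tau> y Kd Kd' d by (simp add: distrib_right)
        finally have "\<bar>b \<tau> * V' y - b s * V' (x s)\<bar> < e" using near0[of "(\<tau>, y)"] by simp
        moreover have "\<bar>i + 1\<bar> < int (r n) * int (r n)"
          using small[of "i + 1" "r n" s "2 * d"] \<tau> elim by (simp add: \<tau>_def)
        then have "real (r n) * (y' - 2 * y + P (r n) i) = b \<tau> * V' y / real (r n)"
          if "y' = P (r n) (i + 2)" for y'
          using minimizer_equation[OF P[OF r(2)[of n]], of "i + 1"] that
          by (simp add: y_def \<tau>_def add.assoc)
        then have "real (r n) * (vel (r n) (i + 1) - vel (r n) i) = b \<tau> * V' y"
          using r(2)[of n] by (simp add: vel_def y_def field_simps)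
        ultimately show "\<bar>real (r n) * (vel (r n) (i + 1) - vel (r n) i) - b s * V' (x s)\<bar> \<le> e" by simp
      qed
    qed
    then show "\<exists>d>0. \<forall>\<^sub>F n in sequentially. \<forall>i. \<bar>of_int i / real (r n) - s\<bar> \<le> d \<longrightarrow>
        \<bar>real (r n) * (vel (r n) (i + 1) - vel (r n) i) - b s * V' (x s)\<bar> \<le> e" using d by blast
  qed
  ultimately show ?thesis using that[OF r x] by blast
qed

end

section \<open>Heteroclinic solutions\<close>

context asymptotically_periodic_well
begin

text \<open>The localisation is uniform in \<open>n\<close>, so the bounds near the wells pass to
  the pointwise limit and give its behaviour at both ends.\<close>

lemma heteroclinic_exists:
  assumes V'_cont: "continuous_on UNIV V'"
  obtains x v where
    "\<And>t. (x has_real_derivative v t) (at t)"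
    "\<And>t. (v has_real_derivative b t * V' (x t)) (at t)"
    "\<And>t. \<bar>x t\<bar> \<le> 1" "(x \<longlongrightarrow> -1) at_bot" "(x \<longlongrightarrow> 1) at_top"
proof -
  have "\<exists>p. minimizer n (int n * int n) p" if "n \<ge> 1" for n
    using that by (intro minimizer_exists) auto
  then obtain P where P: "\<And>n. n \<ge> 1 \<Longrightarrow> minimizer n (int n * int n) (P n)" by metis
  obtain r x v where r: "strict_mono r" "\<And>n. r n \<ge> 1"
    and lim: "\<And>t. (\<lambda>n. P (r n) \<lfloor>t * real (r n)\<rfloor>) \<longlonglongrightarrow> x t"
    and deriv: "\<And>t. (x has_real_derivative v t) (at t)"
      "\<And>t. (v has_real_derivative b t * V' (x t)) (at t)"
    using minimizers_limit[OF b_cont V'_cont P] by blast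
  note min = P[OF r(2)]
  have bound: "\<bar>x t\<bar> \<le> 1" for t
    by (rule tendsto_upperbound[OF tendsto_rabs[OF lim]])
      (auto intro: always_eventually minimizerD(4)[OF min])
  have ends: "\<exists>S. (\<forall>t>S. 1 - e < x t) \<and> (\<forall>t < - S. x t < -1 + e)" if e: "e > 0" for e
  proof -
    define \<delta> where "\<delta> = min (1 / 2) (e / 2)"
    have \<delta>: "0 < \<delta>" "\<delta> \<le> 1 / 2" "\<delta> < e" using e by (auto simp: \<delta>_def)
    obtain S n0 :: nat where S: "\<And>n N p i. n0 \<le> n \<Longrightarrow> int n * int n \<le> N \<Longrightarrow> minimizer n N p \<Longrightarrow>
        (int (S * n) < i \<longrightarrow> 1 - \<delta> < p i) \<and> (i < - int (S * n) \<longrightarrow> p i < -1 + \<delta>)"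
      using minimizer_localized[OF \<delta>(1,2)] by blast
    have large: "\<forall>\<^sub>F n in sequentially. n0 \<le> r n"
      using filterlim_subseq[OF r(1)] by (simp add: filterlim_at_top)
    \<comment> \<open>The extra unit of time absorbs the rounding, so that the floor strictly
      exceeds \<open>S * r n\<close>.\<close>
    have "1 - \<delta> \<le> x t" if t: "t > real (S + 1)" for t
    proof (rule tendsto_lowerbound[OF lim])
      show "\<forall>\<^sub>F n in sequentially. 1 - \<delta> \<le> P (r n) \<lfloor>t * real (r n)\<rfloor>"
        using large
      proof eventually_elim
        case (elim n)
        have "real (S + 1) * real (r n) \<le> t * real (r n)" using t by (intro mult_right_mono) auto
        then have "real_of_int (int (S * r n) + 1) \<le> t * real (r n)" using r(2)[of n] by (simp add: distrib_right)
        then have "int (S * r n) < \<lfloor>t * real (r n)\<rfloor>" by linarith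
        then show ?case using S[OF elim _ min] by (simp add: less_imp_le)
      qed
    qed auto
    moreover have "x t \<le> -1 + \<delta>" if t: "t < - real (S + 1)" for t
    proof (rule tendsto_upperbound[OF lim])
      show "\<forall>\<^sub>F n in sequentially. P (r n) \<lfloor>t * real (r n)\<rfloor> \<le> -1 + \<delta>"
        using large
      proof eventually_elim
        case (elim n)
        have "t * real (r n) < - real (S + 1) * real (r n)"
          using t r(2)[of n] by (intro mult_strict_right_mono) auto
        also have "\<dots> \<le> real_of_int (- int (S * r n))" by (simp add: algebra_simps)
        finally have "t * real (r n) < real_of_int (- int (S * r n))" .
        then have "\<lfloor>t * real (r n)\<rfloor> < - int (S * r n)" by linarith
        then show ?case using S[OF elim _ min] by (simp add: less_imp_le)
      qed
    qed auto
    ultimately show ?thesis using \<delta>(3) by (intro exI[of _ "real (S + 1)"]) fastforce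
  qed
  have "(x \<longlongrightarrow> 1) at_top"
  proof (rule tendstoI)
    fix e :: real assume "e > 0"
    from ends[OF this] obtain S where "\<forall>t>S. 1 - e < x t" by blast
    then have "\<forall>t>S. dist (x t) 1 < e" using bound by (auto simp: dist_real_def abs_le_iff)
    then show "\<forall>\<^sub>F t in at_top. dist (x t) 1 < e" by (auto simp: eventually_at_top_dense)
  qed
  moreover have "(x \<longlongrightarrow> -1) at_bot"
  proof (rule tendstoI)
    fix e :: real assume "e > 0"
    from ends[OF this] obtain S where S: "\<forall>t < - S. x t < -1 + e" by blast
    have "dist (x t) (-1) < e" if "t < -S" for t
      using bound[of t] S that by (auto simp: dist_real_def abs_le_iff)
    then show "\<forall>\<^sub>F t in at_bot. dist (x t) (-1) < e" by (auto simp: eventually_at_bot_dense)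
  qed
  ultimately show ?thesis using that[OF deriv bound] by blast
qed

end

text \<open>Mean value inequality from the zero \<open>z\<close>; it supplies the linear bound that
  \<open>equilibrium_unique\<close> requires at a well.\<close>

lemma linear_bound_at_zero:
  fixes g g' :: "real \<Rightarrow> real"
  assumes g: "\<And>x. (g has_real_derivative g' x) (at x)" and cont: "continuous_on UNIV g'"
    and z: "\<bar>z\<bar> \<le> 1" "g z = 0"
  shows "\<exists>M\<ge>0. \<forall>y. \<bar>y\<bar> \<le> 1 \<longrightarrow> \<bar>g y\<bar> \<le> M * \<bar>y - z\<bar>"
proof -
  have "compact (g' ` {-1..1})"
    by (intro compact_continuous_image continuous_on_subset[OF cont]) auto
  then obtain M where M: "M > 0" "\<And>y. y \<in> {-1..1} \<Longrightarrow> norm (g' y) \<le> M"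
    using compact_imp_bounded bounded_pos by (metis imageI)
  have "norm (g y - g z) \<le> M * norm (y - z)" if "\<bar>y\<bar> \<le> 1" for y
    by (rule field_differentiable_bound[of "{-1..1}" g g' M])
      (use that z M in \<open>auto intro: has_field_derivative_at_within[OF g]\<close>)
  then show ?thesis using M z by (intro exI[of _ M]) auto
qed

section \<open>Rescaling of time and strict bounds\<close>

theorem theorem4p1:
  fixes V V' V'' :: "real \<Rightarrow> real" and a aP :: "real \<Rightarrow> real"
  assumes V_C2: "C2_with V V' V''"
    and V_nonneg: "\<forall>x. V x \<ge> 0"
    and V_zeros: "V (-1) = 0" "V 1 = 0"
    and V_pos: "\<forall>x. -1 < x \<and> x < 1 \<longrightarrow> V x > 0"
    and V_nondeg: "V'' (-1) > 0" "V'' 1 > 0"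
    and a_cont: "continuous_on UNIV a"
    and aP_cont: "continuous_on UNIV aP"
    and aP_periodic: "periodic_fun aP"
    and a_asymp: "((\<lambda>t. \<bar>a t - aP t\<bar>) \<longlongrightarrow> 0) at_infinity"
    and a_inf_pos: "0 < (INF s. a s)"
    and a_bounds: "\<forall>t. (INF s. a s) \<le> a t \<and> a t < aP t"
  shows "\<forall>\<epsilon>>0. \<exists>x x' x''. C2_with x x' x'' \<and>
            (\<forall>t. x'' t = a (\<epsilon> * t) * V' (x t)) \<and>
            (x \<longlongrightarrow> -1) at_bot \<and> (x \<longlongrightarrow> 1) at_top \<and>
            (\<forall>t. -1 < x t \<and> x t < 1)"
proof (intro allI impI)
  fix \<epsilon> :: real assume \<epsilon>: "\<epsilon> > 0"
  have V: "\<And>x. (V has_real_derivative V' x) (at x)" "\<And>x. (V' has_real_derivative V'' x) (at x)"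
    and V''_cont: "continuous_on UNIV V''"
    using V_C2 by (auto simp: C2_with_def)
  have V'_cont: "continuous_on UNIV V'"
    using V(2) by (intro continuous_at_imp_continuous_on ballI DERIV_isCont) auto
  \<comment> \<open>A zero of the nonnegative \<open>V\<close> is a minimum, so both wells are
    equilibria.\<close>
  have crit: "V' z = 0" if "V z = 0" for z
    using DERIV_local_min[OF V(1), of 1 z] V_nonneg that by auto
  obtain T where T: "T > 0" "\<And>t. aP (t + T) = aP t"
    using aP_periodic by (auto simp: periodic_fun_def)
  \<comment> \<open>With \<open>x t = y (t / \<tau>)\<close>, the equation for \<open>x\<close>
    becomes one for \<open>y\<close> with coefficient \<open>\<tau>\<^sup>2 * a (T * t)\<close>,
    because \<open>\<epsilon> * \<tau> = T\<close>; its periodic comparison function has period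
    \<open>1\<close>.\<close>
  define \<tau> where "\<tau> = T / \<epsilon>"
  have \<tau>: "\<tau> > 0" using T \<epsilon> by (simp add: \<tau>_def)
  define b where "b t = \<tau>\<^sup>2 * a (T * t)" for t
  define bP where "bP t = \<tau>\<^sup>2 * aP (T * t)" for t
  have b_cont: "continuous_on UNIV b"
    unfolding b_def by (intro continuous_intros continuous_on_compose2[OF a_cont]) auto
  have bP_cont: "continuous_on UNIV bP"
    unfolding bP_def by (intro continuous_intros continuous_on_compose2[OF aP_cont]) auto
  have bP_periodic: "bP (t + 1) = bP t" for t
    using T(2)[of "T * t"] by (simp add: bP_def algebra_simps)
  have b_less: "b t < bP t" for t
    using a_bounds \<tau> by (simp add: b_def bP_def)
  obtain D where D: "\<And>x. x \<in> {-1..1} \<Longrightarrow> norm (V' x) \<le> D"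
  proof -
    have "compact (V' ` {-1..1})"
      by (intro compact_continuous_image continuous_on_subset[OF V'_cont]) auto
    then show ?thesis using that compact_imp_bounded bounded_pos by (metis imageI)
  qed
  obtain B where B: "\<And>t. b t \<le> B"
  proof -
    have "compact (bP ` {0..1})"
      by (intro compact_continuous_image continuous_on_subset[OF bP_cont]) auto
    then obtain B where B: "\<And>t. t \<in> {0..1} \<Longrightarrow> norm (bP t) \<le> B"
      using compact_imp_bounded bounded_pos by (metis imageI)
    have "b t \<le> B" for t
    proof -
      have "t - of_int \<lfloor>t\<rfloor> \<in> {0..1}" by (simp; linarith)
      from B[OF this] have "bP t \<le> B"
        using unit_periodic_shift[of bP t "\<lfloor>t\<rfloor>"] bP_periodic by simp
      then show ?thesis using b_less[of t] by simp
    qed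
    then show ?thesis by (rule that)
  qed
  interpret asymptotically_periodic_well V V' b "\<tau>\<^sup>2 * (INF s. a s)" B D bP
  proof
    show "((\<lambda>t. \<bar>b t - bP t\<bar>) \<longlongrightarrow> 0) at_infinity"
    proof -
      have "filterlim (\<lambda>t. T * t) at_infinity at_infinity"
        using T by (intro tendsto_mult_filterlim_at_infinity[of _ T] filterlim_ident) auto
      then have "((\<lambda>t. \<bar>a (T * t) - aP (T * t)\<bar>) \<longlongrightarrow> 0) at_infinity"
        by (rule filterlim_compose[OF a_asymp])
      then have "((\<lambda>t. \<tau>\<^sup>2 * \<bar>a (T * t) - aP (T * t)\<bar>) \<longlongrightarrow> \<tau>\<^sup>2 * 0) at_infinity"
        by (rule tendsto_mult_left)
      moreover have "\<bar>b t - bP t\<bar> = \<tau>\<^sup>2 * \<bar>a (T * t) - aP (T * t)\<bar>" for t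
        by (simp add: b_def bP_def right_diff_distrib[symmetric] abs_mult)
      ultimately show ?thesis by simp
    qed
    show "\<tau>\<^sup>2 * (INF s. a s) \<le> b t" for t
      using a_bounds by (auto simp: b_def intro!: mult_left_mono)
    show "\<bar>V' x\<bar> \<le> D" if "\<bar>x\<bar> \<le> 1" for x using D[of x] that by (simp add: abs_le_iff)
  qed (use V V_nonneg V_zeros V_pos a_inf_pos \<tau> B b_cont bP_cont bP_periodic b_less in \<open>auto simp: abs_less_iff\<close>)
  obtain y v where y: "\<And>t. (y has_real_derivative v t) (at t)"
    and v: "\<And>t. (v has_real_derivative b t * V' (y t)) (at t)"
    and y_le: "\<And>t. \<bar>y t\<bar> \<le> 1" and y_lim: "(y \<longlongrightarrow> -1) at_bot" "(y \<longlongrightarrow> 1) at_top"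
    using heteroclinic_exists[OF V'_cont] by blast
  have not_const: False if "\<And>t. y t = z" for z
  proof -
    have "y = (\<lambda>_. z)" using that by (rule ext)
    then show ?thesis using y_lim by (simp add: tendsto_const_iff)
  qed
  \<comment> \<open>A solution touching a well has an extremum there, since
    \<open>\<bar>y t\<bar> \<le> 1\<close>, hence zero velocity. By uniqueness it would be constant,
    contradicting its two different limits.\<close>
  have y_ne: "y s \<noteq> z" if z: "\<bar>z\<bar> = 1" "V z = 0" for s z
  proof
    assume ys: "y s = z"
    obtain M where M: "M \<ge> 0" "\<And>y. \<bar>y\<bar> \<le> 1 \<Longrightarrow> \<bar>V' y\<bar> \<le> M * \<bar>y - z\<bar>"
      using linear_bound_at_zero[OF V(2) V''_cont, of z] crit[OF z(2)] z(1) by auto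
    have v0: "v s = 0"
    proof (cases "z = 1")
      case True
      then show ?thesis using DERIV_local_max[OF y, of 1 s] ys y_le by (auto simp: abs_le_iff)
    next
      case False
      then have "z = -1" using z(1) by linarith
      then show ?thesis using DERIV_local_min[OF y, of 1 s] ys y_le by (auto simp: abs_le_iff minus_le_iff)
    qed
    have w: "\<bar>b t * V' (y t)\<bar> \<le> B * M * \<bar>y t - z\<bar>" for t
    proof -
      have "\<bar>b t\<bar> * \<bar>V' (y t)\<bar> \<le> B * (M * \<bar>y t - z\<bar>)"
        using b_pos[of t] B[of t] B_pos M(2)[OF y_le] by (intro mult_mono) auto
      then show ?thesis by (simp add: abs_mult)
    qed
    have "B * M \<ge> 0" using B_pos M(1) by simp
    then show False using not_const equilibrium_unique[OF y v w _ ys v0] by blast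
  qed
  have y_strict: "-1 < y t \<and> y t < 1" for t
  proof -
    have "y t \<noteq> 1" "y t \<noteq> -1" using y_ne V_zeros by auto
    then show ?thesis using y_le[of t] by linarith
  qed
  define x where "x t = y (t / \<tau>)" for t
  define x' where "x' t = v (t / \<tau>) / \<tau>" for t
  define x'' where "x'' t = a (\<epsilon> * t) * V' (x t)" for t
  have x: "(x has_real_derivative x' t) (at t)" for t
    unfolding x_def x'_def
    by (rule DERIV_cong[OF DERIV_chain2[OF y]]) (use \<tau> in \<open>auto intro!: derivative_eq_intros\<close>)
  have "(x' has_real_derivative b (t / \<tau>) * V' (y (t / \<tau>)) * (1 / \<tau>) / \<tau>) (at t)" for t
    unfolding x'_def
    by (intro DERIV_cdivide DERIV_chain2[OF v]) (use \<tau> in \<open>auto intro!: derivative_eq_intros\<close>)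
  moreover have "b (t / \<tau>) * V' (y (t / \<tau>)) * (1 / \<tau>) / \<tau> = x'' t" for t
    using \<tau> \<epsilon> T by (simp add: b_def x''_def x_def \<tau>_def power2_eq_square field_simps)
  ultimately have x': "(x' has_real_derivative x'' t) (at t)" for t by simp
  have "continuous_on UNIV x"
    using x by (intro continuous_at_imp_continuous_on ballI DERIV_isCont) auto
  then have "continuous_on UNIV x''"
    unfolding x''_def
    by (intro continuous_intros continuous_on_compose2[OF a_cont] continuous_on_compose2[OF V'_cont]) auto
  with x x' have "C2_with x x' x''" by (simp add: C2_with_def)
  moreover have "(x \<longlongrightarrow> -1) at_bot"
    unfolding x_def divide_inverse
    by (rule filterlim_compose[OF y_lim(1)])
      (use \<tau> in \<open>auto intro!: filterlim_tendsto_pos_mult_at_bot filterlim_ident simp: mult.commute[of _ "inverse \<tau>"]\<close>)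
  moreover have "(x \<longlongrightarrow> 1) at_top"
    unfolding x_def divide_inverse
    by (rule filterlim_compose[OF y_lim(2)])
      (use \<tau> in \<open>auto intro!: filterlim_tendsto_pos_mult_at_top filterlim_ident simp: mult.commute[of _ "inverse \<tau>"]\<close>)
  ultimately show "\<exists>x x' x''. C2_with x x' x'' \<and> (\<forall>t. x'' t = a (\<epsilon> * t) * V' (x t)) \<and>
      (x \<longlongrightarrow> -1) at_bot \<and> (x \<longlongrightarrow> 1) at_top \<and> (\<forall>t. -1 < x t \<and> x t < 1)"
    using y_strict by (intro exI[of _ x] exI[of _ x'] exI[of _ x'']) (simp add: x''_def x_def)
qed

end
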